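(* Let $T$ be an $n$-tournament with $n\ge 2$. Then: (i) $T\in\mathcal{D}_1$ if and only if $T$ is switching equivalent to a transitive blowup of $L_2$; (ii) $T\in\mathcal{D}_3\setminus\mathcal{D}_1$ if and only if $T$ is switching equivalent to a transitive blowup of $L_4$; (iii) $T\in\mathcal{D}_3$ if and only if $T$ is switching equivalent to a transitive blowup of $L_k$ for some $k\in\{2,4\}$; (iv) $T\in\mathcal{D}_5\setminus\mathcal{D}_3$ if and only if $T$ is switching equivalent to a transitive blowup of $L_6$; (v) $T\in\mathcal{D}_5$ if and only if $T$ is switching equivalent to a transitive blowup of $L_k$ for some $k\in\{2,4,6\}$.
   Context: A tournament is a directed graph with exactly one arc between each pair of distinct vertices; $u\rightarrow v$ means the arc goes from $u$ to $v$; an $n$-tournament has $n$ vertices. For a tournament $T$ on vertices $v_1,\dots,v_n$, its skew-adjacency matrix is the zero-diagonal matrix $S_T=[s_{ij}]$ with $s_{ij}=-s_{ji}=1$ if $v_i\rightarrow v_j$, and $\det(T):=\det(S_T)$. A subtournament of $T$ is the tournament induced by a nonempty vertex subset (including $T$ itself). For a positive odd integer $k$, $\mathcal{D}_k$ is the set of tournaments all of whose subtournaments have determinant at most $k^2$. A tournament is transitive if it has no directed 3-cycle. The switch of $T$ with respect to $W\subseteq V(T)$ is obtained by reversing all arcs between $W$ and $V(T)\setminus W$; switching equivalent means one is a switch of the other. For an $n$-tournament $R$ with vertices $v_1,\dots,v_n$ and positive integers $a_1,\dots,a_n$, the transitive blowup $R(a_1,\dots,a_n)$ replaces each $v_i$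 by a transitive tournament on $a_i$ vertices, with all arcs from the $i$-th block to the $j$-th block whenever $v_i\rightarrow v_j$ in $R$. For $m\ge 2$, $L_m$ is the tournament on vertices $u_1,\dots,u_m$ with $u_i\rightarrow u_j$ for $1\le i<j\le m-1$, and for $1\le i\le m-1$: $u_m\rightarrow u_i$ if $i$ is odd and $u_i\rightarrow u_m$ if $i$ is even. *)

theory Defs
  imports "Graph_Theory.Graph_Theory" "Jordan_Normal_Form.Determinant"
begin

locale tournament = pair_digraph T for T :: "'a pair_pre_digraph" +
  assumes one_arc: "u \<in> pverts T \<Longrightarrow> v \<in> pverts T \<Longrightarrow> u \<noteq> v \<Longrightarrow>
    ((u, v) \<in> parcs T) \<noteq> ((v, u) \<in> parcs T)"

lemma tournamentI:
  assumes "finite (pverts T)" "parcs T \<subseteq> pverts T \<times> pverts T"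
    "\<And>u. (u, u) \<notin> parcs T"
    "\<And>u v. u \<in> pverts T \<Longrightarrow> v \<in> pverts T \<Longrightarrow> u \<noteq> v \<Longrightarrow>
      ((u, v) \<in> parcs T) \<noteq> ((v, u) \<in> parcs T)"
  shows "tournament T"
proof
  show "fst e \<in> pverts T" "snd e \<in> pverts T" if "e \<in> parcs T" for e
    using subsetD[OF assms(2) that] by (simp_all add: mem_Times_iff)
  show "fst e \<noteq> snd e" if "e \<in> parcs T" for e
    using that assms(3)[of "fst e"] by (cases e) auto
  show "finite (pverts T)" by (rule assms(1))
  show "finite (parcs T)"
    using assms(1,2) by (meson finite_SigmaI finite_subset)
  show "((u, v) \<in> parcs T) \<noteq> ((v, u) \<in> parcs T)"
    if "u \<in> pverts T" "v \<in> pverts T" "u \<noteq> v" for u v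
    using assms(4) that .
qed

definition induced :: "'a pair_pre_digraph \<Rightarrow> 'a set \<Rightarrow> 'a pair_pre_digraph" where
  "induced T W = \<lparr>pverts = W, parcs = {(u, v) \<in> parcs T. u \<in> W \<and> v \<in> W}\<rparr>"

lemma with_proj_induced: "with_proj (induced T W) = with_proj T \<restriction> W"
  by (auto simp: with_proj_def induced_def induce_subgraph_def)

lemma tournament_induced:
  assumes "tournament T" "W \<subseteq> pverts T"
  shows "tournament (induced T W)"
proof -
  interpret tournament T by fact
  have no_loop: "(u, u) \<notin> parcs T" for u
    using pair_no_loops[of "(u, u)"] by auto
  show ?thesis
  proof (rule tournamentI)
    show "finite (pverts (induced T W))"
      using assms(2) pair_finite_verts by (simp add: induced_def finite_subset)
    show "((u, v) \<in> parcs (induced T W)) \<noteq> ((v, u) \<in> parcs (induced T W))"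
      if "u \<in> pverts (induced T W)" "v \<in> pverts (induced T W)" "u \<noteq> v" for u v
      using one_arc[of u v] that assms(2) by (auto simp: induced_def)
  qed (use no_loop in \<open>auto simp: induced_def\<close>)
qed

definition transitive_tournament :: "'a pair_pre_digraph \<Rightarrow> bool" where
  "transitive_tournament T \<longleftrightarrow> tournament T \<and>
     \<not> (\<exists>u v w. (u, v) \<in> parcs T \<and> (v, w) \<in> parcs T \<and> (w, u) \<in> parcs T)"

text \<open>The list \<open>vs\<close> is the labelling \<open>v\<^sub>1, \<dots>, v\<^sub>n\<close> of the vertices.\<close>

definition skew_adjacency_mat :: "'a pair_pre_digraph \<Rightarrow> 'a list \<Rightarrow> int mat" where
  "skew_adjacency_mat T vs = mat (length vs) (length vs) (\<lambda>(i, j).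
     if (vs ! i, vs ! j) \<in> parcs T then 1
     else if (vs ! j, vs ! i) \<in> parcs T then -1
     else 0)"

text \<open>The chosen labelling is irrelevant, see \<open>tdet_eq\<close>.\<close>

definition tdet :: "'a pair_pre_digraph \<Rightarrow> int" where
  "tdet T = det (skew_adjacency_mat T (SOME vs. distinct vs \<and> set vs = pverts T))"

lemma det_skew_adjacency_mat_cong:
  assumes "distinct vs" "distinct ws" "set vs = set ws"
  shows "det (skew_adjacency_mat T vs) = det (skew_adjacency_mat T ws)"
proof -
  define n where "n = length vs"
  have len: "length ws = n"
    using assms by (metis n_def distinct_card)
  have "mset vs = mset ws"
    using assms by (simp add: set_eq_iff_mset_eq_distinct)
  then obtain p where p: "p permutes {..<n}" and vs: "permute_list p ws = vs"
    using mset_eq_permutation[of vs ws] len by auto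
  have p0: "p permutes {0..<n}" using p by (simp add: atLeast0LessThan)
  have nth: "vs ! i = ws ! p i" and lt: "p i < n" if "i < n" for i
    using permute_list_nth[of p ws i] vs p len that permutes_in_image[OF p, of i] by auto
  let ?A = "skew_adjacency_mat T ws"
  let ?B = "mat n n (\<lambda>(i, j). ?A $$ (i, p j))"
  have A: "?A \<in> carrier_mat n n" by (simp add: skew_adjacency_mat_def len)
  have B: "?B \<in> carrier_mat n n" by simp
  have AT: "transpose_mat ?A \<in> carrier_mat n n" using A by simp
  have "skew_adjacency_mat T vs = mat n n (\<lambda>(i, j). ?B $$ (p i, j))"
    by (rule eq_matI) (auto simp: skew_adjacency_mat_def len nth lt simp flip: n_def)
  then have "det (skew_adjacency_mat T vs) = signof p * det ?B"
    using det_permute_rows[OF B p0] by simp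
  also have "det ?B = det (transpose_mat ?B)"
    using det_transpose[OF B] by simp
  also have "transpose_mat ?B = mat n n (\<lambda>(i, j). transpose_mat ?A $$ (p i, j))"
    using A by (intro eq_matI) (auto simp: lt)
  also have "det \<dots> = signof p * det (transpose_mat ?A)"
    using det_permute_rows[OF AT p0] by simp
  also have "det (transpose_mat ?A) = det ?A"
    using det_transpose[OF A] .
  finally show ?thesis
    by (simp add: sign_def)
qed

lemma tdet_eq:
  assumes "distinct vs" "set vs = pverts T"
  shows "tdet T = det (skew_adjacency_mat T vs)"
proof -
  let ?ws = "SOME ws. distinct ws \<and> set ws = pverts T"
  have "distinct ?ws \<and> set ?ws = pverts T"
    by (rule someI[of _ vs]) (use assms in simp)
  then show ?thesis
    unfolding tdet_def using assms by (intro det_skew_adjacency_mat_cong) auto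
qed

definition tournaments_D :: "nat \<Rightarrow> 'a pair_pre_digraph set" where
  "tournaments_D k = {T. tournament T \<and>
     (\<forall>W \<subseteq> pverts T. W \<noteq> {} \<longrightarrow> tdet (induced T W) \<le> (int k)\<^sup>2)}"

definition switch :: "'a pair_pre_digraph \<Rightarrow> 'a set \<Rightarrow> 'a pair_pre_digraph" where
  "switch T W = \<lparr>pverts = pverts T, parcs =
     {(u, v). if (u \<in> W) = (v \<in> W) then (u, v) \<in> parcs T else (v, u) \<in> parcs T}\<rparr>"

definition switching_equivalent :: "'a pair_pre_digraph \<Rightarrow> 'a pair_pre_digraph \<Rightarrow> bool" where
  "switching_equivalent T T' \<longleftrightarrow> (\<exists>W \<subseteq> pverts T. T' = switch T W)"

text \<open>
  The block \<open>P i\<close> replaces the vertex \<open>i\<close> of \<open>R\<close>. Blowups are described up to isomorphism: the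
  vertices of the blocks are arbitrary elements of the type \<open>'a\<close>.
\<close>

definition is_transitive_blowup ::
    "'a pair_pre_digraph \<Rightarrow> 'b pair_pre_digraph \<Rightarrow> ('b \<Rightarrow> nat) \<Rightarrow> bool" where
  "is_transitive_blowup B R a \<longleftrightarrow> tournament B \<and> (\<exists>P.
     disjoint_family_on P (pverts R) \<and> pverts B = (\<Union>i\<in>pverts R. P i) \<and>
     (\<forall>i\<in>pverts R. card (P i) = a i \<and> transitive_tournament (induced B (P i))) \<and>
     (\<forall>i j. (i, j) \<in> parcs R \<longrightarrow> (\<forall>x\<in>P i. \<forall>y\<in>P j. (x, y) \<in> parcs B)))"

definition switching_equivalent_to_blowup_of ::
    "'a pair_pre_digraph \<Rightarrow> 'b pair_pre_digraph \<Rightarrow> bool" where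
  "switching_equivalent_to_blowup_of T R \<longleftrightarrow>
     (\<exists>a B. (\<forall>i\<in>pverts R. 0 < a i) \<and> is_transitive_blowup B R a \<and> switching_equivalent T B)"

definition Ltour :: "nat \<Rightarrow> nat pair_pre_digraph" where
  "Ltour m = \<lparr>pverts = {1..m}, parcs =
     {(i, j). 1 \<le> i \<and> i < j \<and> j \<le> m - 1} \<union>
     {(m, i) |i. 1 \<le> i \<and> i \<le> m - 1 \<and> odd i} \<union>
     {(i, m) |i. 1 \<le> i \<and> i \<le> m - 1 \<and> even i}\<rparr>"

lemma tournament_switch:
  assumes "tournament T"
  shows "tournament (switch T W)"
proof -
  interpret tournament T by fact
  have no_loop: "(u, u) \<notin> parcs T" for u
    using pair_no_loops[of "(u, u)"] by auto
  have arc: "(u, v) \<in> parcs (switch T W) \<longleftrightarrow>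
      (if (u \<in> W) = (v \<in> W) then (u, v) \<in> parcs T else (v, u) \<in> parcs T)" for u v
    by (simp add: switch_def)
  show ?thesis
  proof (rule tournamentI)
    show "finite (pverts (switch T W))"
      using pair_finite_verts by (simp add: switch_def)
    show "parcs (switch T W) \<subseteq> pverts (switch T W) \<times> pverts (switch T W)"
    proof (rule subrelI)
      fix u v assume "(u, v) \<in> parcs (switch T W)"
      then have "(u, v) \<in> parcs T \<or> (v, u) \<in> parcs T"
        unfolding arc by presburger
      then have "u \<in> pverts T \<and> v \<in> pverts T"
        using in_arcsD1 in_arcsD2 by blast
      then show "(u, v) \<in> pverts (switch T W) \<times> pverts (switch T W)"
        by (simp add: switch_def)
    qed
    show "(u, u) \<notin> parcs (switch T W)" for u
      unfolding arc using no_loop by simp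
    show "((u, v) \<in> parcs (switch T W)) \<noteq> ((v, u) \<in> parcs (switch T W))"
      if "u \<in> pverts (switch T W)" "v \<in> pverts (switch T W)" "u \<noteq> v" for u v
    proof -
      have "u \<in> pverts T" "v \<in> pverts T"
        using that by (simp_all add: switch_def)
      from one_arc[OF this that(3)] show ?thesis
        unfolding arc by argo
    qed
  qed
qed

lemma switching_equivalent_sym:
  assumes "switching_equivalent T T'"
  shows "switching_equivalent T' T"
proof -
  from assms obtain W where W: "W \<subseteq> pverts T" "T' = switch T W"
    unfolding switching_equivalent_def by blast
  have "T = switch (switch T W) W"
    by (cases T) (simp add: switch_def eq_commute cong: if_cong)
  moreover have "pverts T' = pverts T"
    using W(2) by (simp add: switch_def)
  ultimately show ?thesis
    unfolding switching_equivalent_def using W by metis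
qed

lemma tournament_Ltour: "tournament (Ltour m)"
proof (rule tournamentI)
  show "((u, v) \<in> parcs (Ltour m)) \<noteq> ((v, u) \<in> parcs (Ltour m))"
    if "u \<in> pverts (Ltour m)" "v \<in> pverts (Ltour m)" "u \<noteq> v" for u v
  proof (cases "u = m \<or> v = m")
    case True
    with that show ?thesis by (auto simp: Ltour_def)
  next
    case False
    with that show ?thesis by (auto simp: Ltour_def)
  qed
  show "finite (pverts (Ltour m))"
    by (simp add: Ltour_def)
  show "parcs (Ltour m) \<subseteq> pverts (Ltour m) \<times> pverts (Ltour m)"
    by (rule subrelI) (auto simp: Ltour_def)
  show "(u, u) \<notin> parcs (Ltour m)" for u
    by (auto simp: Ltour_def)
qed

end

theory Submission
  imports Defs
begin

text \<open>
  Up to switching, a tournament is a skew-symmetric sign matrix. Eliminating a unit pivot shows that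
  two vertices which see all others alike can be deleted from a principal minor, so the minors of a
  transitive blowup are minors of its pattern. The same elimination turns the minor of a chain
  together with one further vertex \<open>w\<close> into the square of the alternating sum of the signs of \<open>w\<close>,
  whence \<open>det L\<^sub>m = (m - 1)\<^sup>2\<close> for even \<open>m\<close>, and no minor of \<open>L\<^sub>m\<close> is larger.

  Conversely, a tournament that is not switching equivalent to a transitive one contains \<open>L\<^sub>4\<close>.
  Let \<open>R\<close> be a copy of \<open>L\<^sub>4\<close> or \<open>L\<^sub>6\<close> in a tournament of \<open>\<D>\<^sub>5\<close>. Every vertex sees
  \<open>R\<close> like one of the vertices of \<open>R\<close>: for \<open>L\<^sub>4\<close> this is automatic, for \<open>L\<^sub>6\<close> all other sign
  vectors create a Pfaffian of modulus at least 7 on six vertices. A 3-cycle among vertices of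
  one type multiplies the determinant of \<open>R\<close> by 9. If \<open>x\<close>, \<open>y\<close> look like \<open>u \<noteq> v\<close> but the arc between
  \<open>x\<close> and \<open>y\<close> is wrong, then the Pfaffian of \<open>R\<close> together with \<open>x\<close>, \<open>y\<close> is
  \<open>\<plusminus>Pf(R - u - v) \<plusminus> 2 Pf(R)\<close>: for \<open>L\<^sub>6\<close> its modulus is at least 7, and for \<open>L\<^sub>4\<close> it is 5 or 7,
  where 5 forces a copy of \<open>L\<^sub>6\<close>.
\<close>

section \<open>Minors of skew-symmetric matrices\<close>

definition minor :: "('a \<Rightarrow> 'b \<Rightarrow> 'c :: comm_ring_1) \<Rightarrow> 'a list \<Rightarrow> 'b list \<Rightarrow> 'c" where
  "minor f rs cs = det (mat (length rs) (length cs) (\<lambda>(i, j). f (rs ! i) (cs ! j)))"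

abbreviation principal_minor :: "('a \<Rightarrow> 'a \<Rightarrow> 'c :: comm_ring_1) \<Rightarrow> 'a list \<Rightarrow> 'c" where
  "principal_minor f vs \<equiv> minor f vs vs"

lemma minor_Nil [simp]: "minor f [] [] = 1"
  by (simp add: minor_def)

lemma minor_cong:
  assumes "\<And>x y. x \<in> set rs \<Longrightarrow> y \<in> set cs \<Longrightarrow> f x y = g x y"
  shows "minor f rs cs = minor g rs cs"
  unfolding minor_def by (rule arg_cong[where f = det], rule eq_matI) (auto intro: assms)

lemma minor_map: "minor f (map a rs) (map b cs) = minor (\<lambda>i j. f (a i) (b j)) rs cs"
  unfolding minor_def by (rule arg_cong[where f = det], rule eq_matI) auto

lemma minor_transpose:
  assumes "length rs = length cs"
  shows "minor (\<lambda>x y. f y x) cs rs = minor f rs cs"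
proof -
  have "mat (length cs) (length rs) (\<lambda>(i, j). f (rs ! j) (cs ! i)) =
      transpose_mat (mat (length rs) (length cs) (\<lambda>(i, j). f (rs ! i) (cs ! j)))"
    by (rule eq_matI) auto
  then show ?thesis
    unfolding minor_def using assms by (simp add: det_transpose[of _ "length cs"])
qed

lemma minor_permute_rows:
  assumes "p permutes {..<length rs}" "length rs = length cs"
  shows "minor f (permute_list p rs) cs = of_int (sign p) * minor f rs cs"
proof -
  let ?A = "mat (length cs) (length cs) (\<lambda>(i, j). f (rs ! i) (cs ! j))"
  have p: "p permutes {0..<length cs}"
    using assms by (simp add: atLeast0LessThan)
  have "mat (length cs) (length cs) (\<lambda>(i, j). f (permute_list p rs ! i) (cs ! j)) =
      mat (length cs) (length cs) (\<lambda>(i, j). ?A $$ (p i, j))"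
    using permutes_in_image[OF p] assms by (intro eq_matI) (auto simp: permute_list_nth)
  then show ?thesis
    using det_permute_rows[OF _ p, of ?A] assms(2) by (simp add: minor_def)
qed

lemma principal_minor_permute:
  assumes "mset vs = mset ws"
  shows "principal_minor f vs = principal_minor f ws"
proof -
  obtain p where p: "p permutes {..<length ws}" and vs: "vs = permute_list p ws"
    using mset_eq_permutation[OF assms] by blast
  have len: "length vs = length ws"
    by (simp add: vs)
  have "principal_minor f vs = of_int (sign p) * minor (\<lambda>x y. f y x) vs ws"
    using minor_permute_rows[OF p, of vs f] minor_transpose[of ws vs f] len vs by simp
  also have "minor (\<lambda>x y. f y x) vs ws = of_int (sign p) * principal_minor f ws"
    using minor_permute_rows[OF p, of ws "\<lambda>x y. f y x"] minor_transpose[of ws ws f] vs by simp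
  finally show ?thesis
    by (simp add: sign_def split: if_splits)
qed

lemma principal_minor_set_cong:
  assumes "distinct vs" "distinct ws" "set vs = set ws"
  shows "principal_minor f vs = principal_minor f ws"
  using assms by (intro principal_minor_permute) (simp add: set_eq_iff_mset_eq_distinct)

lemma minor_scale:
  assumes "length rs = length cs"
  shows "minor (\<lambda>x y. a x * b y * f x y) rs cs =
    prod_list (map a rs) * prod_list (map b cs) * minor f rs cs"
proof -
  let ?n = "length cs"
  have factor: "(\<Prod>i<?n. a (rs ! i) * b (cs ! p i) * f (rs ! i) (cs ! p i)) =
      prod_list (map a rs) * prod_list (map b cs) * (\<Prod>i<?n. f (rs ! i) (cs ! p i))"
    if "p permutes {..<?n}" for p
    using prod.permute[OF that, of "\<lambda>i. b (cs ! i)"] assms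
    by (simp add: prod.distrib prod.list_conv_set_nth o_def flip: atLeast0LessThan)
  have "p i < ?n" if "p permutes {..<?n}" "i < ?n" for p i
    using permutes_in_image[OF that(1), of i] that(2) by simp
  then show ?thesis
    unfolding minor_def using assms
    by (subst (1 2) det_def'[of _ ?n])
      (auto simp: sum_distrib_left factor atLeast0LessThan mult.left_commute intro!: sum.cong)
qed

lemma minor_Cons:
  assumes "length rs = Suc (length cs)"
  shows "minor f rs (c # cs) =
    (\<Sum>i<length rs. (-1) ^ i * f (rs ! i) c * minor f (take i rs @ drop (Suc i) rs) cs)"
proof -
  let ?A = "mat (length rs) (length rs) (\<lambda>(i, j). f (rs ! i) ((c # cs) ! j))"
  have "mat_delete ?A i 0 = mat (length cs) (length cs)
      (\<lambda>(k, l). f ((take i rs @ drop (Suc i) rs) ! k) (cs ! l))" if "i < length rs" for i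
    using that assms by (intro eq_matI) (auto simp: mat_delete_def nth_append)
  then show ?thesis
    unfolding minor_def using assms
    by (subst laplace_expansion_column[of _ "length rs" 0])
      (auto simp: cofactor_def min_def mult_ac intro!: sum.cong)
qed

lemma minor_2: "minor f [x, y] [a, b] = f x a * f y b - f y a * f x b"
  by (simp add: minor_Cons)

lemma minor_3:
  "minor f [x, y, z] [a, b, c] = f x a * minor f [y, z] [b, c]
    - f y a * minor f [x, z] [b, c] + f z a * minor f [x, y] [b, c]"
  by (subst minor_Cons) simp_all

lemma minor_4:
  "minor f [w, x, y, z] [a, b, c, d] = f w a * minor f [x, y, z] [b, c, d]
    - f x a * minor f [w, y, z] [b, c, d] + f y a * minor f [w, x, z] [b, c, d]
    - f z a * minor f [w, x, y] [b, c, d]"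
  by (subst minor_Cons) simp_all

lemma det_four_block_mat_schur:
  fixes A :: "'a :: idom mat"
  assumes "A \<in> carrier_mat n n" "B \<in> carrier_mat n m" "X \<in> carrier_mat m n" "D \<in> carrier_mat m m"
  shows "det (four_block_mat A B (X * A) (X * B + D)) = det A * det D"
proof -
  have "four_block_mat A B (X * A) (X * B + D) =
      four_block_mat (1\<^sub>m n) (0\<^sub>m n m) X (1\<^sub>m m) * four_block_mat A B (0\<^sub>m m n) D"
    using assms by (subst mult_four_block_mat[of _ n n _ m _ m]) auto
  also have "det \<dots> = det (four_block_mat (1\<^sub>m n) (0\<^sub>m n m) X (1\<^sub>m m)) *
      det (four_block_mat A B (0\<^sub>m m n) D)"
    using assms by (intro det_mult[of _ "n + m"] four_block_carrier_mat) simp_all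
  also have "det (four_block_mat (1\<^sub>m n) (0\<^sub>m n m) X (1\<^sub>m m)) = 1"
    using det_four_block_mat_upper_right_zero[OF _ refl assms(3), of "1\<^sub>m n" "1\<^sub>m m"] by simp
  also have "det (four_block_mat A B (0\<^sub>m m n) D) = det A * det D"
    by (rule det_four_block_mat_lower_left_zero[OF assms(1,2) refl assms(4)])
  finally show ?thesis
    by simp
qed

definition skew :: "('a \<Rightarrow> 'a \<Rightarrow> int) \<Rightarrow> bool" where
  "skew f \<longleftrightarrow> (\<forall>x y. f y x = - f x y)"

lemma skewD: "skew f \<Longrightarrow> f y x = - f x y"
  unfolding skew_def by blast

lemma skew_self: "skew f \<Longrightarrow> f x x = 0"
  using skewD[of f x x] by simp

lemma skew_eqI:
  fixes r s :: "'a :: linorder \<Rightarrow> 'a \<Rightarrow> int"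
  assumes "skew r" "skew s" "\<And>i j. i \<in> I \<Longrightarrow> j \<in> I \<Longrightarrow> i < j \<Longrightarrow> r i j = s i j"
    and "i \<in> I" "j \<in> I"
  shows "r i j = s i j"
  using assms skewD[OF assms(1), of i j] skewD[OF assms(2), of i j]
  by (cases i j rule: linorder_cases) (simp_all add: skew_self)

lemma principal_minor_odd:
  assumes "skew f" "odd (length vs)"
  shows "principal_minor f vs = 0"
proof -
  have "principal_minor f vs = principal_minor (\<lambda>x y. f y x) vs"
    by (rule minor_transpose[symmetric]) simp
  also have "\<dots> = principal_minor (\<lambda>x y. (-1) * 1 * f x y) vs"
    by (rule minor_cong) (simp, rule skewD[OF assms(1)])
  also have "\<dots> = - principal_minor f vs"
    by (subst minor_scale) (simp_all add: assms(2) map_replicate_const)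
  finally show ?thesis
    by simp
qed

lemma principal_minor_2:
  assumes "skew f"
  shows "principal_minor f [a, b] = (f a b)\<^sup>2"
  using skewD[OF assms, of b a] by (simp add: minor_2 skew_self[OF assms] power2_eq_square)

text \<open>The Schur complement of the block \<open>{a, b}\<close>, if \<open>f a b\<close> is its own inverse.\<close>

definition schur_complement ::
    "('a \<Rightarrow> 'a \<Rightarrow> int) \<Rightarrow> 'a \<Rightarrow> 'a \<Rightarrow> 'a \<Rightarrow> 'a \<Rightarrow> int" where
  "schur_complement f a b x y = f x y + f a b * (f x a * f b y - f x b * f a y)"

lemma skew_schur_complement:
  assumes "skew f"
  shows "skew (schur_complement f a b)"
  unfolding skew_def schur_complement_def
proof (intro allI)
  fix x y
  have "f y x = - f x y" "f y a = - f a y" "f b x = - f x b" "f y b = - f b y" "f a x = - f x a"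
    using assms by (rule skewD)+
  then show "f y x + f a b * (f y a * f b x - f y b * f a x) =
      - (f x y + f a b * (f x a * f b y - f x b * f a y))"
    by (simp add: algebra_simps)
qed

lemma principal_minor_schur_complement:
  assumes skew: "skew f" and unit: "f a b \<in> {1, -1}"
  shows "principal_minor f (a # b # vs) = principal_minor (schur_complement f a b) vs"
proof -
  let ?n = "length vs"
  let ?c = "f a b"
  have c: "?c * ?c = 1" "?c * (?c * x) = x" and ba: "f b a = - ?c" for x
    using unit skewD[OF skew, of b a] by auto
  define A where "A = mat 2 2 (\<lambda>(i, j). f ([a, b] ! i) ([a, b] ! j))"
  define B where "B = mat 2 ?n (\<lambda>(i, j). f ([a, b] ! i) (vs ! j))"
  define X where "X = mat ?n 2 (\<lambda>(i, j). if j = 0 then ?c * f (vs ! i) b else - ?c * f (vs ! i) a)"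
  define D where "D = mat ?n ?n (\<lambda>(i, j). schur_complement f a b (vs ! i) (vs ! j))"
  have XA: "X * A = mat ?n 2 (\<lambda>(i, j). f (vs ! i) ([a, b] ! j))"
    by (rule eq_matI) (auto simp: X_def A_def scalar_prod_def numeral_2_eq_2 less_Suc_eq
        skew_self[OF skew] ba algebra_simps c)
  have XBD: "X * B + D = mat ?n ?n (\<lambda>(i, j). f (vs ! i) (vs ! j))"
    by (rule eq_matI) (auto simp: X_def B_def D_def schur_complement_def scalar_prod_def
        numeral_2_eq_2 algebra_simps)
  have "mat (length (a # b # vs)) (length (a # b # vs))
      (\<lambda>(i, j). f ((a # b # vs) ! i) ((a # b # vs) ! j)) = four_block_mat A B (X * A) (X * B + D)"
    unfolding XA XBD by (rule eq_matI) (auto simp: A_def B_def nth_Cons' numeral_2_eq_2)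
  then have "principal_minor f (a # b # vs) = det A * det D"
    unfolding minor_def by (simp add: det_four_block_mat_schur[of _ 2 _ ?n] A_def B_def X_def D_def)
  also have "det A = 1"
    using principal_minor_2[OF skew, of a b] c
    by (simp add: minor_def A_def numeral_2_eq_2 power2_eq_square)
  finally show ?thesis
    by (simp add: minor_def D_def)
qed

lemma principal_minor_twins:
  assumes "skew f" "f a b \<in> {1, -1}" "\<And>x. x \<in> set vs \<Longrightarrow> f a x = f b x"
  shows "principal_minor f (a # b # vs) = principal_minor f vs"
proof -
  have "f x a = f x b" if "x \<in> set vs" for x
    using assms(3)[OF that] skewD[OF assms(1), of a x] skewD[OF assms(1), of b x] by simp
  then have "principal_minor (schur_complement f a b) vs = principal_minor f vs"
    by (intro minor_cong) (simp add: schur_complement_def assms(3))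
  then show ?thesis
    by (simp only: principal_minor_schur_complement[OF assms(1,2)])
qed

lemma principal_minor_cyclic_triple:
  assumes skew: "skew f" and cyc: "f a b = 1" "f b c = 1" "f c a = 1" and c: "c \<notin> set vs"
    and twins: "\<And>x. x \<in> set vs \<Longrightarrow> f a x = f c x" "\<And>x. x \<in> set vs \<Longrightarrow> f b x = f c x"
  shows "principal_minor f (a # b # c # vs) = 9 * principal_minor f (c # vs)"
proof -
  \<comment> \<open>Eliminating \<open>a\<close> and \<open>b\<close> multiplies the row and the column of \<open>c\<close> by 3.\<close>
  define e :: "_ \<Rightarrow> int" where "e x = (if x = c then 3 else 1)" for x
  note rev = skewD[OF skew]
  have twins': "f x a = f x c" "f x b = f x c" if "x \<in> set vs" for x
    using twins[OF that] rev[of a x] rev[of b x] rev[of c x] by simp_all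
  have "f c b = -1" "f a c = -1"
    using rev[of b c] rev[of c a] cyc by simp_all
  then have "schur_complement f a b x y = e x * e y * f x y"
    if "x \<in> set (c # vs)" "y \<in> set (c # vs)" for x y
    using that c
    by (auto simp: schur_complement_def e_def cyc twins twins' skew_self[OF skew] algebra_simps)
  then have "principal_minor f (a # b # c # vs) = principal_minor (\<lambda>x y. e x * e y * f x y) (c # vs)"
    using cyc by (subst principal_minor_schur_complement[OF skew]) (auto intro: minor_cong)
  also have "\<dots> = (prod_list (map e (c # vs)))\<^sup>2 * principal_minor f (c # vs)"
    by (simp add: minor_scale power2_eq_square)
  also have "map e vs = map (\<lambda>x. 1) vs"
    using c by (auto simp: e_def)
  then have "prod_list (map e (c # vs)) = 3"
    by (simp add: e_def map_replicate_const)
  finally show ?thesis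
    by simp
qed

definition pfaffian4 :: "('a \<Rightarrow> 'a \<Rightarrow> int) \<Rightarrow> 'a \<Rightarrow> 'a \<Rightarrow> 'a \<Rightarrow> 'a \<Rightarrow> int" where
  "pfaffian4 f a b c d = f a b * f c d - f a c * f b d + f a d * f b c"

definition pfaffian6 ::
    "('a \<Rightarrow> 'a \<Rightarrow> int) \<Rightarrow> 'a \<Rightarrow> 'a \<Rightarrow> 'a \<Rightarrow> 'a \<Rightarrow> 'a \<Rightarrow> 'a \<Rightarrow> int" where
  "pfaffian6 f a b c d e g = f a b * pfaffian4 f c d e g - f a c * pfaffian4 f b d e g
     + f a d * pfaffian4 f b c e g - f a e * pfaffian4 f b c d g + f a g * pfaffian4 f b c d e"

lemma principal_minor_4:
  assumes "skew f"
  shows "principal_minor f [a, b, c, d] = (pfaffian4 f a b c d)\<^sup>2"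
proof -
  have "f b a = - f a b" "f c a = - f a c" "f d a = - f a d"
    "f c b = - f b c" "f d b = - f b d" "f d c = - f c d"
    using assms by (rule skewD)+
  then show ?thesis
    by (simp add: minor_4 minor_3 minor_2 skew_self[OF assms] pfaffian4_def power2_eq_square algebra_simps)
qed

lemma principal_minor_6:
  assumes "skew f" and unit: "f a b \<in> {1, -1}"
  shows "principal_minor f [a, b, c, d, e, g] = (pfaffian6 f a b c d e g)\<^sup>2"
proof -
  have rev: "f x a = - f a x" "f x b = - f b x" for x
    using assms(1) by (rule skewD)+
  have "pfaffian4 (schur_complement f a b) c d e g = f a b * pfaffian6 f a b c d e g"
    using unit
    by (auto simp: pfaffian4_def pfaffian6_def schur_complement_def
        rev[of c] rev[of d] rev[of e] rev[of g] algebra_simps)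
  then have "(pfaffian4 (schur_complement f a b) c d e g)\<^sup>2 = (pfaffian6 f a b c d e g)\<^sup>2"
    using unit by auto
  then show ?thesis
    by (simp only: principal_minor_schur_complement[OF assms]
        principal_minor_4[OF skew_schur_complement[OF assms(1)]])
qed

section \<open>Switching and blowups of sign matrices\<close>

definition signing :: "'a set \<Rightarrow> ('a \<Rightarrow> int) \<Rightarrow> bool" where
  "signing V d \<longleftrightarrow> (\<forall>x\<in>V. d x \<in> {1, -1})"

lemma signingD: "signing V d \<Longrightarrow> x \<in> V \<Longrightarrow> d x \<in> {1, -1}"
  unfolding signing_def by blast

lemma signing_subset: "signing V d \<Longrightarrow> W \<subseteq> V \<Longrightarrow> signing W d"
  unfolding signing_def by blast

lemma signing_mult: "signing V c \<Longrightarrow> signing V d \<Longrightarrow> signing V (\<lambda>x. c x * d x)"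
  unfolding signing_def by fastforce

definition switched :: "('a \<Rightarrow> int) \<Rightarrow> ('a \<Rightarrow> 'a \<Rightarrow> int) \<Rightarrow> 'a \<Rightarrow> 'a \<Rightarrow> int" where
  "switched d f = (\<lambda>x y. d x * d y * f x y)"

lemma switched_switched: "switched c (switched d f) = switched (\<lambda>x. c x * d x) f"
  by (simp add: switched_def mult_ac)

lemma skew_switched: "skew f \<Longrightarrow> skew (switched d f)"
  unfolding skew_def switched_def by (metis mult.commute mult_minus_right)

lemma principal_minor_switched:
  assumes "signing (set vs) d"
  shows "principal_minor (switched d f) vs = principal_minor f vs"
proof -
  have "(prod_list (map d vs))\<^sup>2 = 1"
    using assms by (induction vs) (auto simp: signing_def power_mult_distrib)
  then show ?thesis
    using minor_scale[of vs vs d d f] by (simp add: switched_def power2_eq_square)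
qed

definition minors_le :: "'a set \<Rightarrow> ('a \<Rightarrow> 'a \<Rightarrow> int) \<Rightarrow> int \<Rightarrow> bool" where
  "minors_le V f c \<longleftrightarrow> (\<forall>vs. distinct vs \<longrightarrow> set vs \<subseteq> V \<longrightarrow> principal_minor f vs \<le> c)"

lemma minors_leI:
  "(\<And>vs. distinct vs \<Longrightarrow> set vs \<subseteq> V \<Longrightarrow> principal_minor f vs \<le> c) \<Longrightarrow> minors_le V f c"
  unfolding minors_le_def by blast

lemma minors_leD:
  "minors_le V f c \<Longrightarrow> distinct vs \<Longrightarrow> set vs \<subseteq> V \<Longrightarrow> principal_minor f vs \<le> c"
  unfolding minors_le_def by blast

lemma minors_le_switched_iff:
  assumes "signing V d"
  shows "minors_le V (switched d f) c \<longleftrightarrow> minors_le V f c"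
  using principal_minor_switched[OF signing_subset[OF assms]] unfolding minors_le_def by metis

definition transitive_on :: "('a \<Rightarrow> 'a \<Rightarrow> int) \<Rightarrow> 'a set \<Rightarrow> bool" where
  "transitive_on f A \<longleftrightarrow>
    \<not> (\<exists>x\<in>A. \<exists>y\<in>A. \<exists>z\<in>A. f x y = 1 \<and> f y z = 1 \<and> f z x = 1)"

lemma transitive_on_subset: "transitive_on f A \<Longrightarrow> B \<subseteq> A \<Longrightarrow> transitive_on f B"
  unfolding transitive_on_def by blast

lemma transitive_on_cong:
  assumes "\<And>x y. x \<in> A \<Longrightarrow> y \<in> A \<Longrightarrow> f x y = g x y"
  shows "transitive_on f A \<longleftrightarrow> transitive_on g A"
  by (simp add: transitive_on_def assms)

locale sign_matrix =
  fixes V :: "'a set" and f :: "'a \<Rightarrow> 'a \<Rightarrow> int"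
  assumes skew: "skew f"
    and unit: "x \<in> V \<Longrightarrow> y \<in> V \<Longrightarrow> x \<noteq> y \<Longrightarrow> f x y \<in> {1, -1}"
begin

lemma sign_matrix_switched:
  assumes "signing V d"
  shows "sign_matrix V (switched d f)"
proof
  show "skew (switched d f)"
    by (rule skew_switched[OF skew])
  show "switched d f x y \<in> {1, -1}" if "x \<in> V" "y \<in> V" "x \<noteq> y" for x y
    using signingD[OF assms that(1)] signingD[OF assms that(2)] unit[OF that]
    by (auto simp: switched_def)
qed

lemma transitive_on_trans:
  assumes "transitive_on f A" "A \<subseteq> V" "x \<in> A" "y \<in> A" "z \<in> A" "f x y = 1" "f y z = 1"
  shows "f x z = 1"
proof -
  have "x \<noteq> z"
    using assms(6,7) skewD[OF skew, of x y] by auto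
  then have "f x z \<in> {1, -1}"
    using assms by (intro unit) auto
  moreover have "f z x \<noteq> 1"
    using assms unfolding transitive_on_def by blast
  ultimately show ?thesis
    using skewD[OF skew, of x z] by auto
qed

lemma transitive_on_source:
  assumes "finite A" "A \<noteq> {}" "A \<subseteq> V" "transitive_on f A"
  obtains s where "s \<in> A" "\<And>x. x \<in> A - {s} \<Longrightarrow> f s x = 1"
proof -
  have "\<exists>s\<in>A. \<forall>x\<in>A - {s}. f s x = 1"
    using assms
  proof (induction rule: finite_ne_induct)
    case (insert a F)
    then obtain s where s: "s \<in> F" "\<forall>x\<in>F - {s}. f s x = 1"
      using transitive_on_subset[of f "insert a F" F] by blast
    show ?case
    proof (cases "f s a = 1")
      case True
      then show ?thesis
        using s by blast
    next
      case False
      then have as: "f a s = 1"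
        using unit[of a s] insert.hyps insert.prems s(1) skewD[OF skew, of a s] by auto
      have "f a x = 1" if "x \<in> F - {s}" for x
        using transitive_on_trans[OF insert.prems(2,1), of a s x] as s that by auto
      then show ?thesis
        using as insert.hyps(3) by (intro bexI[of _ a]) auto
    qed
  qed simp
  then show thesis
    using that by blast
qed

end

definition copy_in ::
    "'a set \<Rightarrow> ('a \<Rightarrow> 'a \<Rightarrow> int) \<Rightarrow> 'b set \<Rightarrow> ('b \<Rightarrow> 'b \<Rightarrow> int) \<Rightarrow> ('b \<Rightarrow> 'a) \<Rightarrow> bool" where
  "copy_in V f I r l \<longleftrightarrow> inj_on l I \<and> l ` I \<subseteq> V \<and> (\<forall>i\<in>I. \<forall>j\<in>I. f (l i) (l j) = r i j)"

definition contains_copy ::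
    "'a set \<Rightarrow> ('a \<Rightarrow> 'a \<Rightarrow> int) \<Rightarrow> 'b set \<Rightarrow> ('b \<Rightarrow> 'b \<Rightarrow> int) \<Rightarrow> bool" where
  "contains_copy V f I r \<longleftrightarrow> (\<exists>d l. signing V d \<and> copy_in V (switched d f) I r l)"

lemma contains_copy_switched:
  assumes "contains_copy V (switched d f) I r" "signing V d"
  shows "contains_copy V f I r"
  using assms signing_mult unfolding contains_copy_def switched_switched by blast

lemma principal_minor_copy:
  assumes "copy_in V f I r l" "set ns \<subseteq> I"
  shows "principal_minor f (map l ns) = principal_minor r ns"
  using assms unfolding minor_map copy_in_def by (intro minor_cong) blast

lemma contains_copy_minors_le:
  assumes "contains_copy V f I r" "minors_le V f c"
  shows "minors_le I r c"
proof (rule minors_leI)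
  fix ns assume ns: "distinct ns" "set ns \<subseteq> I"
  obtain d l where d: "signing V d" and l: "copy_in V (switched d f) I r l"
    using assms(1) unfolding contains_copy_def by blast
  have "distinct (map l ns)" "set (map l ns) \<subseteq> V"
    using ns l unfolding copy_in_def distinct_map by (auto intro: inj_on_subset)
  moreover have "minors_le V (switched d f) c"
    using assms(2) minors_le_switched_iff[OF d] by blast
  ultimately show "principal_minor r ns \<le> c"
    using minors_leD principal_minor_copy[OF l ns(2)] by metis
qed

locale transitive_blowup = sign_matrix V f + pattern: sign_matrix I r
  for V :: "'a set" and f and I :: "'b set" and r +
  fixes \<tau> :: "'a \<Rightarrow> 'b"
  assumes type_image: "\<tau> ` V = I"
    and cross: "x \<in> V \<Longrightarrow> y \<in> V \<Longrightarrow> \<tau> x \<noteq> \<tau> y \<Longrightarrow> f x y = r (\<tau> x) (\<tau> y)"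
    and block_transitive: "i \<in> I \<Longrightarrow> transitive_on f {x \<in> V. \<tau> x = i}"
begin

lemma obtain_twins:
  assumes "finite W" "W \<subseteq> V" "\<not> inj_on \<tau> W"
  obtains x y where "x \<in> W" "y \<in> W" "x \<noteq> y" "\<And>w. w \<in> W - {x, y} \<Longrightarrow> f x w = f y w"
proof -
  obtain a b where ab: "a \<in> W" "b \<in> W" "a \<noteq> b" "\<tau> a = \<tau> b"
    using assms(3) by (auto simp: inj_on_def)
  define A where "A = {w \<in> W. \<tau> w = \<tau> a}"
  have A: "finite A" "A \<subseteq> V" "a \<in> A" "b \<in> A"
    using assms ab by (auto simp: A_def)
  have trans: "transitive_on f A"
    using assms(2) type_image ab(1)
    by (intro transitive_on_subset[OF block_transitive[of "\<tau> a"]]) (auto simp: A_def)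
  obtain x where x: "x \<in> A" "\<And>w. w \<in> A - {x} \<Longrightarrow> f x w = 1"
    using transitive_on_source[OF A(1) _ A(2) trans] A(3) by blast
  have "finite (A - {x})" "A - {x} \<noteq> {}" "A - {x} \<subseteq> V" "transitive_on f (A - {x})"
    using A ab(3) transitive_on_subset[OF trans, of "A - {x}"] by blast+
  then obtain y where y: "y \<in> A - {x}" "\<And>w. w \<in> A - {x} - {y} \<Longrightarrow> f y w = 1"
    using transitive_on_source by blast
  have "f x w = f y w" if "w \<in> W - {x, y}" for w
  proof (cases "\<tau> w = \<tau> a")
    case True
    then have "w \<in> A"
      using that by (simp add: A_def)
    then show ?thesis
      using x(2)[of w] y(2)[of w] that by simp
  next
    case False
    moreover have "x \<in> V" "y \<in> V" "w \<in> V" "\<tau> x = \<tau> a" "\<tau> y = \<tau> a"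
      using x(1) y(1) that assms(2) by (auto simp: A_def)
    ultimately show ?thesis
      by (simp add: cross)
  qed
  moreover have "x \<in> W" "y \<in> W" "x \<noteq> y"
    using x y by (auto simp: A_def)
  ultimately show thesis
    using that by blast
qed

lemma principal_minor_transversal:
  assumes "set vs \<subseteq> V" "inj_on \<tau> (set vs)"
  shows "principal_minor f vs = principal_minor r (map \<tau> vs)"
  unfolding minor_map
proof (rule minor_cong)
  fix x y assume "x \<in> set vs" "y \<in> set vs"
  then show "f x y = r (\<tau> x) (\<tau> y)"
    using assms cross[of x y]
    by (cases "x = y") (auto simp: skew_self[OF skew] skew_self[OF pattern.skew] dest: inj_onD)
qed

lemma minors_le_pattern:
  assumes "minors_le I r c"
  shows "minors_le V f c"
proof (rule minors_leI)
  fix vs assume "distinct vs" "set vs \<subseteq> V"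
  then show "principal_minor f vs \<le> c"
  proof (induction vs rule: length_induct)
    case (1 vs)
    show ?case
    proof (cases "inj_on \<tau> (set vs)")
      case True
      then show ?thesis
        unfolding principal_minor_transversal[OF "1.prems"(2) True]
        using "1.prems" type_image by (intro minors_leD[OF assms]) (auto simp: distinct_map)
    next
      case False
      then obtain x y where xy: "x \<in> set vs" "y \<in> set vs" "x \<noteq> y"
        and twins: "\<And>w. w \<in> set vs - {x, y} \<Longrightarrow> f x w = f y w"
        using obtain_twins[of "set vs"] "1.prems"(2) by blast
      let ?ws = "filter (\<lambda>w. w \<noteq> x \<and> w \<noteq> y) vs"
      have "principal_minor f vs = principal_minor f (x # y # ?ws)"
        using "1.prems"(1) xy by (intro principal_minor_set_cong) auto
      also have "\<dots> = principal_minor f ?ws"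
        using unit[of x y] xy "1.prems"(2) twins by (intro principal_minor_twins[OF skew]) auto
      also have "\<dots> \<le> c"
        using "1.prems" xy(1) by (intro "1.IH"[rule_format] length_filter_less) auto
      finally show ?thesis .
    qed
  qed
qed

lemma copy_in_inv_into: "copy_in V f I r (inv_into V \<tau>)"
  unfolding copy_in_def
proof (intro conjI ballI)
  show "inj_on (inv_into V \<tau>) I"
    using type_image by (simp add: inj_on_inv_into)
  show "inv_into V \<tau> ` I \<subseteq> V"
    unfolding type_image[symmetric] by (auto intro: inv_into_into)
  fix i j assume "i \<in> I" "j \<in> I"
  then have "inv_into V \<tau> i \<in> V" "\<tau> (inv_into V \<tau> i) = i" "inv_into V \<tau> j \<in> V" "\<tau> (inv_into V \<tau> j) = j"
    using type_image by (auto simp: inv_into_into f_inv_into_f)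
  then show "f (inv_into V \<tau> i) (inv_into V \<tau> j) = r i j"
    using cross[of "inv_into V \<tau> i" "inv_into V \<tau> j"]
    by (cases "i = j") (auto simp: skew_self[OF skew] skew_self[OF pattern.skew])
qed

lemma transitive_blowup_cong:
  assumes "skew g" "\<And>x y. x \<in> V \<Longrightarrow> y \<in> V \<Longrightarrow> g x y = f x y"
  shows "transitive_blowup V g I r \<tau>"
proof
  show "transitive_on g {x \<in> V. \<tau> x = i}" if "i \<in> I" for i
    using block_transitive[OF that] transitive_on_cong[of "{x \<in> V. \<tau> x = i}" f g] assms(2)
    by simp
qed (use assms unit cross type_image in auto)

end

definition switched_blowup ::
    "'a set \<Rightarrow> ('a \<Rightarrow> 'a \<Rightarrow> int) \<Rightarrow> 'b set \<Rightarrow> ('b \<Rightarrow> 'b \<Rightarrow> int) \<Rightarrow> bool" where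
  "switched_blowup V f I r \<longleftrightarrow>
    (\<exists>d \<tau>. signing V d \<and> transitive_blowup V (switched d f) I r \<tau>)"

lemma switched_blowup_switched:
  assumes "switched_blowup V (switched d f) I r" "signing V d"
  shows "switched_blowup V f I r"
  using assms signing_mult unfolding switched_blowup_def switched_switched by blast

lemma switched_blowup_minors_le_iff:
  assumes "switched_blowup V f I r"
  shows "minors_le V f c \<longleftrightarrow> minors_le I r c"
proof -
  obtain d \<tau> where d: "signing V d" and "transitive_blowup V (switched d f) I r \<tau>"
    using assms unfolding switched_blowup_def by blast
  then interpret transitive_blowup V "switched d f" I r \<tau>
    by simp
  have "contains_copy V f I r"
    using d copy_in_inv_into unfolding contains_copy_def by blast
  then show ?thesis
    using contains_copy_minors_le minors_le_pattern minors_le_switched_iff[OF d] by blast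
qed

section \<open>Tournaments as sign matrices\<close>

definition arc_sign :: "'a pair_pre_digraph \<Rightarrow> 'a \<Rightarrow> 'a \<Rightarrow> int" where
  "arc_sign T u v = (if (u, v) \<in> parcs T then 1 else if (v, u) \<in> parcs T then -1 else 0)"

lemma arc_sign_eq_1_iff: "arc_sign T u v = 1 \<longleftrightarrow> (u, v) \<in> parcs T"
  by (simp add: arc_sign_def)

lemma tournament_finite:
  assumes "tournament T"
  shows "finite (pverts T)"
proof -
  interpret tournament T by fact
  show ?thesis by (rule pair_finite_verts)
qed

lemma tournament_asym:
  assumes "tournament T" "(u, v) \<in> parcs T"
  shows "(v, u) \<notin> parcs T"
proof -
  interpret tournament T by fact
  show ?thesis
    using assms(2) one_arc[of u v] in_arcsD1 in_arcsD2 pair_no_loops by fastforce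
qed

lemma sign_matrix_arc_sign:
  assumes "tournament T"
  shows "sign_matrix (pverts T) (arc_sign T)"
proof
  show "skew (arc_sign T)"
    using tournament_asym[OF assms] by (auto simp: skew_def arc_sign_def)
  show "arc_sign T x y \<in> {1, -1}" if "x \<in> pverts T" "y \<in> pverts T" "x \<noteq> y" for x y
    using tournament.one_arc[OF assms that] by (auto simp: arc_sign_def)
qed

lemma tdet_induced:
  assumes "distinct vs"
  shows "tdet (induced T (set vs)) = principal_minor (arc_sign T) vs"
proof -
  have "skew_adjacency_mat (induced T (set vs)) vs =
      mat (length vs) (length vs) (\<lambda>(i, j). arc_sign T (vs ! i) (vs ! j))"
    by (rule eq_matI) (auto simp: skew_adjacency_mat_def arc_sign_def induced_def)
  then show ?thesis
    using tdet_eq[of vs "induced T (set vs)"] assms by (simp add: minor_def induced_def)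
qed

lemma tournaments_D_iff_minors_le:
  assumes "tournament T" "k > 0"
  shows "T \<in> tournaments_D k \<longleftrightarrow> minors_le (pverts T) (arc_sign T) ((int k)\<^sup>2)"
proof
  assume T: "T \<in> tournaments_D k"
  show "minors_le (pverts T) (arc_sign T) ((int k)\<^sup>2)"
  proof (rule minors_leI)
    fix vs assume vs: "distinct vs" "set vs \<subseteq> pverts T"
    then have "vs \<noteq> [] \<Longrightarrow> tdet (induced T (set vs)) \<le> (int k)\<^sup>2"
      using T by (auto simp: tournaments_D_def)
    then show "principal_minor (arc_sign T) vs \<le> (int k)\<^sup>2"
      using tdet_induced[OF vs(1), of T] assms(2) by (cases "vs = []") auto
  qed
next
  assume bound: "minors_le (pverts T) (arc_sign T) ((int k)\<^sup>2)"
  have "tdet (induced T W) \<le> (int k)\<^sup>2" if W: "W \<subseteq> pverts T" for W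
  proof -
    obtain vs where "distinct vs" "set vs = W"
      using finite_distinct_list[OF finite_subset[OF W tournament_finite[OF assms(1)]]] by blast
    then show ?thesis
      using minors_leD[OF bound, of vs] W tdet_induced[of vs T] by simp
  qed
  then show "T \<in> tournaments_D k"
    using assms(1) by (simp add: tournaments_D_def)
qed

lemma arc_sign_switch:
  assumes "tournament T"
  shows "arc_sign (switch T W) = switched (\<lambda>x. if x \<in> W then -1 else 1) (arc_sign T)"
  using tournament_asym[OF assms] by (auto simp: fun_eq_iff switched_def arc_sign_def switch_def)

lemma transitive_tournament_induced_iff:
  assumes "tournament T" "W \<subseteq> pverts T"
  shows "transitive_tournament (induced T W) \<longleftrightarrow> transitive_on (arc_sign T) W"
  using tournament_induced[OF assms]
  unfolding transitive_tournament_def transitive_on_def arc_sign_eq_1_iff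
  by (auto simp: induced_def)

lemma transitive_blowup_imp_is_transitive_blowup:
  assumes B: "tournament B" and R: "tournament R"
    and blowup: "transitive_blowup (pverts B) (arc_sign B) (pverts R) (arc_sign R) \<tau>"
  shows "\<exists>a. (\<forall>i\<in>pverts R. 0 < a i) \<and> is_transitive_blowup B R a"
proof -
  interpret transitive_blowup "pverts B" "arc_sign B" "pverts R" "arc_sign R" \<tau>
    by fact
  let ?P = "\<lambda>i. {x \<in> pverts B. \<tau> x = i}"
  have "transitive_tournament (induced B (?P i))" if "i \<in> pverts R" for i
    using block_transitive[OF that] transitive_tournament_induced_iff[OF B, of "?P i"] by simp
  moreover have "(x, y) \<in> parcs B" if "(i, j) \<in> parcs R" "x \<in> ?P i" "y \<in> ?P j" for i j x y
  proof -
    have "i \<noteq> j"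
      using tournament_asym[OF R that(1)] that(1) by auto
    then show ?thesis
      using that cross[of x y] by (simp flip: arc_sign_eq_1_iff)
  qed
  moreover have "disjoint_family_on ?P (pverts R)" "pverts B = (\<Union>i\<in>pverts R. ?P i)"
    using type_image by (auto simp: disjoint_family_on_def)
  ultimately have "is_transitive_blowup B R (\<lambda>i. card (?P i))"
    unfolding is_transitive_blowup_def using B by (intro conjI exI[of _ ?P]) blast+
  moreover have "0 < card (?P i)" if "i \<in> pverts R" for i
  proof -
    have "i \<in> \<tau> ` pverts B"
      using that type_image by simp
    then show ?thesis
      using tournament_finite[OF B] by (auto simp: card_gt_0_iff)
  qed
  ultimately show ?thesis
    by (intro exI[of _ "\<lambda>i. card (?P i)"] conjI ballI)
qed

lemma disjoint_family_on_obtain_index: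
  assumes "disjoint_family_on P I"
  obtains \<tau> where "\<And>x. x \<in> (\<Union>i\<in>I. P i) \<Longrightarrow> \<tau> x \<in> I"
    "\<And>i. i \<in> I \<Longrightarrow> {x \<in> (\<Union>i\<in>I. P i). \<tau> x = i} = P i"
proof -
  have "\<forall>x\<in>(\<Union>i\<in>I. P i). \<exists>i. i \<in> I \<and> x \<in> P i"
    by blast
  from bchoice[OF this] obtain \<tau> where \<tau>: "\<And>x. x \<in> (\<Union>i\<in>I. P i) \<Longrightarrow> \<tau> x \<in> I \<and> x \<in> P (\<tau> x)"
    by blast
  have "\<tau> x = i" if "i \<in> I" "x \<in> P i" for i x
    using \<tau>[of x] that assms unfolding disjoint_family_on_def by blast
  then have "{x \<in> (\<Union>i\<in>I. P i). \<tau> x = i} = P i" if "i \<in> I" for i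
    using \<tau> that by auto
  with \<tau> show thesis
    by (intro that[of \<tau>]) simp_all
qed

lemma obtain_transitive_blowup:
  assumes blowup: "is_transitive_blowup B R a" and pos: "\<forall>i\<in>pverts R. 0 < a i" and R: "tournament R"
  obtains \<tau> where "transitive_blowup (pverts B) (arc_sign B) (pverts R) (arc_sign R) \<tau>"
proof -
  have B: "tournament B"
    using blowup unfolding is_transitive_blowup_def by (rule conjunct1)
  obtain P where dis: "disjoint_family_on P (pverts R)" and verts: "pverts B = (\<Union>i\<in>pverts R. P i)"
    and blocks: "\<forall>i\<in>pverts R. card (P i) = a i \<and> transitive_tournament (induced B (P i))"
    and arcs: "\<forall>i j. (i, j) \<in> parcs R \<longrightarrow> (\<forall>x\<in>P i. \<forall>y\<in>P j. (x, y) \<in> parcs B)"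
    using blowup unfolding is_transitive_blowup_def by blast
  obtain \<tau> where \<tau>: "\<And>x. x \<in> pverts B \<Longrightarrow> \<tau> x \<in> pverts R"
    and block: "\<And>i. i \<in> pverts R \<Longrightarrow> {x \<in> pverts B. \<tau> x = i} = P i"
    using disjoint_family_on_obtain_index[OF dis] unfolding verts by blast
  interpret B: sign_matrix "pverts B" "arc_sign B" by (rule sign_matrix_arc_sign[OF B])
  interpret R: sign_matrix "pverts R" "arc_sign R" by (rule sign_matrix_arc_sign[OF R])
  have "transitive_blowup (pverts B) (arc_sign B) (pverts R) (arc_sign R) \<tau>"
  proof
    have "\<exists>x\<in>pverts B. \<tau> x = i" if "i \<in> pverts R" for i
      using that blocks pos block[OF that] by (metis (mono_tags) card.empty empty_Collect_eq less_irrefl)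
    then show "\<tau> ` pverts B = pverts R"
      using \<tau> by auto
  next
    fix x y assume xy: "x \<in> pverts B" "y \<in> pverts B" "\<tau> x \<noteq> \<tau> y"
    then have "x \<in> P (\<tau> x)" "y \<in> P (\<tau> y)"
      using block \<tau> by blast+
    then have "(\<tau> x, \<tau> y) \<in> parcs R \<and> (x, y) \<in> parcs B \<or> (\<tau> y, \<tau> x) \<in> parcs R \<and> (y, x) \<in> parcs B"
      using tournament.one_arc[OF R, of "\<tau> x" "\<tau> y"] \<tau> xy arcs by blast
    then show "arc_sign B x y = arc_sign R (\<tau> x) (\<tau> y)"
      using tournament_asym[OF B] tournament_asym[OF R] by (auto simp: arc_sign_def)
  next
    show "transitive_on (arc_sign B) {x \<in> pverts B. \<tau> x = i}" if "i \<in> pverts R" for i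
      using that blocks block transitive_tournament_induced_iff[OF B, of "P i"] verts by auto
  qed
  then show thesis
    by (rule that)
qed

lemma switching_equivalent_to_blowup_of_iff:
  assumes T: "tournament T" and R: "tournament R"
  shows "switching_equivalent_to_blowup_of T R \<longleftrightarrow>
    switched_blowup (pverts T) (arc_sign T) (pverts R) (arc_sign R)"
proof
  assume "switching_equivalent_to_blowup_of T R"
  then obtain a W where a: "\<forall>i\<in>pverts R. 0 < a i" "is_transitive_blowup (switch T W) R a"
    unfolding switching_equivalent_to_blowup_of_def switching_equivalent_def by blast
  obtain \<tau> where "transitive_blowup (pverts T) (arc_sign (switch T W)) (pverts R) (arc_sign R) \<tau>"
    using obtain_transitive_blowup[OF a(2,1) R] by (auto simp: switch_def)
  moreover have "signing (pverts T) (\<lambda>x. if x \<in> W then -1 else 1)"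
    by (simp add: signing_def)
  ultimately show "switched_blowup (pverts T) (arc_sign T) (pverts R) (arc_sign R)"
    unfolding switched_blowup_def arc_sign_switch[OF T] by blast
next
  assume "switched_blowup (pverts T) (arc_sign T) (pverts R) (arc_sign R)"
  then obtain d \<tau> where d: "signing (pverts T) d"
    and blowup: "transitive_blowup (pverts T) (switched d (arc_sign T)) (pverts R) (arc_sign R) \<tau>"
    unfolding switched_blowup_def by blast
  define B where "B = switch T {x \<in> pverts T. d x = -1}"
  have B: "tournament B" "pverts B = pverts T"
    by (simp_all add: B_def tournament_switch[OF T]) (simp add: switch_def)
  have "switched d (arc_sign T) x y = arc_sign B x y" if "x \<in> pverts T" "y \<in> pverts T" for x y
    using that signingD[OF d, of x] signingD[OF d, of y]
    by (auto simp: B_def arc_sign_switch[OF T] switched_def)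
  then have blowup_B: "transitive_blowup (pverts B) (arc_sign B) (pverts R) (arc_sign R) \<tau>"
    unfolding B(2) using sign_matrix.skew[OF sign_matrix_arc_sign[OF B(1)]]
    by (intro transitive_blowup.transitive_blowup_cong[OF blowup]) auto
  have "switching_equivalent T B"
    unfolding switching_equivalent_def
    by (rule exI[of _ "{x \<in> pverts T. d x = -1}"]) (auto simp: B_def)
  then show "switching_equivalent_to_blowup_of T R"
    using transitive_blowup_imp_is_transitive_blowup[OF B(1) R blowup_B]
    unfolding switching_equivalent_to_blowup_of_def by blast
qed

lemma switching_blowup_in_tournaments_D_iff:
  assumes "tournament T" "tournament R" "switching_equivalent_to_blowup_of T R" "k > 0"
  shows "T \<in> tournaments_D k \<longleftrightarrow> R \<in> tournaments_D k"
  using assms switched_blowup_minors_le_iff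
  by (simp add: tournaments_D_iff_minors_le switching_equivalent_to_blowup_of_iff)

section \<open>The tournaments \<open>L\<^sub>m\<close>\<close>

lemma principal_minor_chain:
  assumes skew: "skew f" and chain: "sorted_wrt (\<lambda>x y. f x y = 1) xs"
  shows "principal_minor f xs = (if even (length xs) then 1 else 0)"
proof (cases "even (length xs)")
  case True
  then have "principal_minor f xs = 1"
    using chain
  proof (induction xs rule: induct_list012)
    case (3 x y zs)
    then have "principal_minor f (x # y # zs) = principal_minor f zs"
      by (intro principal_minor_twins[OF skew]) auto
    then show ?case
      using 3 by simp
  qed simp_all
  then show ?thesis
    using True by simp
next
  case False
  then show ?thesis
    using principal_minor_odd[OF skew] by simp
qed

lemma schur_complement_chain:
  assumes "skew f" "f x y = 1" "f x z = 1" "f y z = 1"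
  shows "schur_complement f x y z w = f z w + (f x w - f y w)"
  using assms(2-4) skewD[OF assms(1), of z x] skewD[OF assms(1), of z y]
  by (simp add: schur_complement_def)

lemma sum_alternating_signs: "(\<Sum>k<n. (-1) ^ k) = (if even n then 0 else 1 :: int)"
  by (induction n) auto

lemma principal_minor_chain_snoc:
  assumes "skew f" "sorted_wrt (\<lambda>x y. f x y = 1) xs" "odd (length xs)"
  shows "principal_minor f (xs @ [w]) = (\<Sum>k<length xs. (-1) ^ k * f (xs ! k) w)\<^sup>2"
  using assms
proof (induction xs arbitrary: f rule: induct_list012)
  case (2 x)
  then show ?case
    by (simp add: principal_minor_2)
next
  case (3 x y zs)
  let ?g = "schur_complement f x y"
  let ?n = "length zs"
  have n: "odd ?n"
    using "3.prems"(3) by simp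
  have schur: "?g z z' = f z z' + (f x z' - f y z')" if "z \<in> set zs" for z z'
    using "3.prems"(2) that by (intro schur_complement_chain[OF "3.prems"(1)]) auto
  then have chain: "sorted_wrt (\<lambda>x y. ?g x y = 1) zs"
    using "3.prems"(2) by (auto intro: sorted_wrt_mono_rel[of zs "\<lambda>x y. f x y = 1"])
  have "principal_minor f ((x # y # zs) @ [w]) = principal_minor ?g (zs @ [w])"
    using "3.prems"(2) by (simp add: principal_minor_schur_complement[OF "3.prems"(1)])
  also have "\<dots> = (\<Sum>k<?n. (-1) ^ k * ?g (zs ! k) w)\<^sup>2"
    by (rule "3.IH"(1)[OF skew_schur_complement[OF "3.prems"(1)] chain n])
  also have "(\<Sum>k<?n. (-1) ^ k * ?g (zs ! k) w) =
      (\<Sum>k<?n. (-1) ^ k * f (zs ! k) w) + (\<Sum>k<?n. (-1) ^ k) * (f x w - f y w)"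
    by (simp add: schur distrib_left sum.distrib flip: sum_distrib_right)
  also have "\<dots> = (\<Sum>k<length (x # y # zs). (-1) ^ k * f ((x # y # zs) ! k) w)"
    using n by (simp add: sum_alternating_signs sum.lessThan_Suc_shift del: sum.lessThan_Suc)
  finally show ?case .
qed simp

lemma principal_minor_chain_snoc_le:
  assumes skew: "skew f" and chain: "sorted_wrt (\<lambda>x y. f x y = 1) xs"
    and signs: "\<And>x. x \<in> set xs \<Longrightarrow> \<bar>f x w\<bar> \<le> 1"
  shows "principal_minor f (xs @ [w]) \<le> (int (length xs))\<^sup>2"
proof (cases "even (length xs)")
  case True
  then show ?thesis
    by (simp add: principal_minor_odd[OF skew])
next
  case False
  have "\<bar>\<Sum>k<length xs. (-1) ^ k * f (xs ! k) w\<bar> \<le> (\<Sum>k<length xs. \<bar>(-1) ^ k * f (xs ! k) w\<bar>)"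
    by (rule sum_abs)
  also have "\<dots> \<le> (\<Sum>k<length xs. 1)"
    by (rule sum_mono) (simp add: abs_mult signs)
  finally show ?thesis
    unfolding principal_minor_chain_snoc[OF skew chain False]
    by (intro abs_le_square_iff[THEN iffD1]) simp
qed

abbreviation L_sign :: "nat \<Rightarrow> nat \<Rightarrow> nat \<Rightarrow> int" where
  "L_sign m \<equiv> arc_sign (Ltour m)"

lemma pverts_Ltour [simp]: "pverts (Ltour m) = {1..m}"
  by (simp add: Ltour_def)

lemma sign_matrix_L_sign: "sign_matrix {1..m} (L_sign m)"
  using sign_matrix_arc_sign[OF tournament_Ltour, of m] by simp

lemmas skew_L_sign = sign_matrix.skew[OF sign_matrix_L_sign]

lemma L_sign_less:
  assumes "1 \<le> i" "i < j" "j \<le> m"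
  shows "L_sign m i j = (if j < m \<or> even i then 1 else -1)"
  using assms by (auto simp: arc_sign_def Ltour_def)

lemma L_sign_greater:
  assumes "1 \<le> j" "j < i" "i \<le> m"
  shows "L_sign m i j = (if i < m \<or> even j then -1 else 1)"
  using L_sign_less[OF assms] skewD[OF skew_L_sign, of m i j] by simp

lemma sorted_wrt_L_sign:
  assumes "sorted_wrt (<) ns" "set ns \<subseteq> {1..<m}"
  shows "sorted_wrt (\<lambda>i j. L_sign m i j = 1) ns"
proof (rule sorted_wrt_mono_rel[OF _ assms(1)])
  fix i j assume "i \<in> set ns" "j \<in> set ns" "i < j"
  moreover from this have "1 \<le> i" "j < m"
    using assms(2) by auto
  ultimately show "L_sign m i j = 1"
    by (simp add: L_sign_less)
qed

lemma minors_le_L_sign: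
  assumes "2 \<le> m"
  shows "minors_le {1..m} (L_sign m) ((int m - 1)\<^sup>2)"
proof (rule minors_leI)
  fix ns :: "nat list" assume ns: "distinct ns" "set ns \<subseteq> {1..m}"
  define js where "js = sorted_list_of_set (set ns - {m})"
  have js: "sorted_wrt (<) js" "distinct js" "set js = set ns - {m}"
    by (simp_all add: js_def)
  then have js_sub: "set js \<subseteq> {1..<m}"
    using ns(2) by fastforce
  note chain = sorted_wrt_L_sign[OF js(1) js_sub]
  show "principal_minor (L_sign m) ns \<le> (int m - 1)\<^sup>2"
  proof (cases "m \<in> set ns")
    case False
    then have "principal_minor (L_sign m) ns = principal_minor (L_sign m) js"
      using ns js by (intro principal_minor_set_cong) auto
    also have "\<dots> \<le> 1\<^sup>2"
      by (simp add: principal_minor_chain[OF skew_L_sign chain])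
    also have "\<dots> \<le> (int m - 1)\<^sup>2"
      using assms by (intro power_mono) simp_all
    finally show ?thesis .
  next
    case True
    then have "principal_minor (L_sign m) ns = principal_minor (L_sign m) (js @ [m])"
      using ns js by (intro principal_minor_set_cong) auto
    also have "\<dots> \<le> (int (length js))\<^sup>2"
      by (rule principal_minor_chain_snoc_le[OF skew_L_sign chain]) (simp add: arc_sign_def)
    also have "\<dots> \<le> (int m - 1)\<^sup>2"
      using card_mono[OF _ js_sub] distinct_card[OF js(2)] assms by (intro power_mono) simp_all
    finally show ?thesis .
  qed
qed

lemma principal_minor_L_sign:
  assumes "even m" "2 \<le> m" "distinct ns" "set ns = {1..m}"
  shows "principal_minor (L_sign m) ns = (int m - 1)\<^sup>2"
proof -
  have chain: "sorted_wrt (\<lambda>i j. L_sign m i j = 1) [1..<m]"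
    by (rule sorted_wrt_L_sign) auto
  have "set ([1..<m] @ [m]) = set ns"
    using assms(2) unfolding assms(4) by auto
  then have "principal_minor (L_sign m) ns = principal_minor (L_sign m) ([1..<m] @ [m])"
    using assms(3) by (intro principal_minor_set_cong) simp_all
  also have "\<dots> = (\<Sum>k<m - 1. (-1) ^ k * L_sign m (Suc k) m)\<^sup>2"
    using principal_minor_chain_snoc[OF skew_L_sign chain, of m] assms(1,2) by simp
  also have "(\<Sum>k<m - 1. (-1) ^ k * L_sign m (Suc k) m) = (\<Sum>k<m - 1. -1)"
    by (rule sum.cong) (auto simp: L_sign_less)
  finally show ?thesis
    using assms(2) by (simp add: of_nat_diff power2_commute)
qed

lemma Ltour_in_tournaments_D_iff:
  assumes "even m" "2 \<le> m" "k > 0"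
  shows "Ltour m \<in> tournaments_D k \<longleftrightarrow> m - 1 \<le> k"
proof -
  have listing: "distinct [1..<Suc m]" "set [1..<Suc m] = {1..m}"
    by auto
  have "minors_le {1..m} (L_sign m) c \<longleftrightarrow> (int m - 1)\<^sup>2 \<le> c" for c
  proof
    assume "minors_le {1..m} (L_sign m) c"
    then show "(int m - 1)\<^sup>2 \<le> c"
      using minors_leD[OF _ listing(1)] principal_minor_L_sign[OF assms(1,2) listing] listing(2)
      by fastforce
  next
    assume "(int m - 1)\<^sup>2 \<le> c"
    then show "minors_le {1..m} (L_sign m) c"
      using minors_le_L_sign[OF assms(2)] unfolding minors_le_def by fastforce
  qed
  then show ?thesis
    using assms abs_le_square_iff[of "int m - 1" "int k"]
    by (auto simp: tournaments_D_iff_minors_le[OF tournament_Ltour])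
qed

abbreviation contains_L :: "nat \<Rightarrow> 'a set \<Rightarrow> ('a \<Rightarrow> 'a \<Rightarrow> int) \<Rightarrow> bool" where
  "contains_L m V f \<equiv> contains_copy V f {1..m} (L_sign m)"

lemma (in sign_matrix) contains_L_chainI:
  assumes chain: "sorted_wrt (\<lambda>x y. f x y = 1) xs"
    and alternating: "\<And>k. k < length xs \<Longrightarrow> f (xs ! k) w = (-1) ^ k"
    and V: "distinct (w # xs)" "set (w # xs) \<subseteq> V" and m: "m = Suc (length xs)"
  shows "contains_L m V f"
proof -
  define d :: "'a \<Rightarrow> int" where "d x = (if x = w then -1 else 1)" for x
  define l where "l i = (xs @ [w]) ! (i - 1)" for i
  have l_xs: "l i = xs ! (i - 1)" "d (l i) = 1" if "1 \<le> i" "i < m" for i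
    using that m V(1) nth_mem[of "i - 1" xs] by (auto simp: l_def d_def nth_append)
  have "switched d f (l i) (l j) = L_sign m i j" if "i \<in> {1..m}" "j \<in> {1..m}" "i < j" for i j
  proof (cases "j = m")
    case True
    then show ?thesis
      using that l_xs[of i] alternating[of "i - 1"] m
      by (cases i) (auto simp: switched_def d_def l_def L_sign_less)
  next
    case False
    then have "f (l i) (l j) = 1"
      using that m l_xs[of i] l_xs[of j] sorted_wrt_nth_less[OF chain, of "i - 1" "j - 1"] by simp
    then show ?thesis
      using False that l_xs[of i] l_xs[of j] by (simp add: switched_def L_sign_less)
  qed
  then have "\<forall>i\<in>{1..m}. \<forall>j\<in>{1..m}. switched d f (l i) (l j) = L_sign m i j"
    using skew_eqI[of "\<lambda>i j. switched d f (l i) (l j)" "L_sign m"] skew_L_sign[of m]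
      skew_switched[OF skew, of d] unfolding skew_def by blast
  moreover have "inj_on l {1..m}"
    using V(1) m by (auto simp: inj_on_def l_def nth_eq_iff_index_eq)
  moreover have "l i \<in> set (xs @ [w])" if "i \<in> {1..m}" for i
    unfolding l_def using that m by (intro nth_mem) auto
  then have "l ` {1..m} \<subseteq> V"
    using V(2) by fastforce
  moreover have "signing V d"
    by (simp add: signing_def d_def)
  ultimately show ?thesis
    unfolding contains_copy_def copy_in_def by blast
qed

section \<open>Conflicting vertices\<close>

lemma (in sign_matrix) abs_pfaffian4_le:
  assumes "distinct [a, b, c, d]" "{a, b, c, d} \<subseteq> V"
  shows "\<bar>pfaffian4 f a b c d\<bar> \<le> 3"
proof -
  have "\<bar>f x y\<bar> = 1" if "x \<in> {a, b, c, d}" "y \<in> {a, b, c, d}" "x \<noteq> y" for x y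
    using unit[of x y] that assms(2) by auto
  then have "\<bar>f a b * f c d\<bar> = 1" "\<bar>f a c * f b d\<bar> = 1" "\<bar>f a d * f b c\<bar> = 1"
    using assms(1) by (simp_all add: abs_mult)
  then show ?thesis
    unfolding pfaffian4_def by linarith
qed

text \<open>Below, \<open>u\<close> and \<open>v\<close> form together with \<open>K\<close> a copy of \<open>L\<^sub>4\<close> or \<open>L\<^sub>6\<close>, and \<open>x\<close>, \<open>y\<close> look like \<open>u\<close>, \<open>v\<close>.\<close>

locale conflict = sign_matrix V f for V :: "'a set" and f +
  fixes u x v y :: 'a and K :: "'a set"
  assumes distinct: "distinct [u, x, v, y]" "K \<inter> {u, x, v, y} = {}"
    and subset: "{u, x, v, y} \<subseteq> V" "K \<subseteq> V"
    and x_like_u: "z \<in> insert v K \<Longrightarrow> f x z = f u z"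
    and y_like_v: "z \<in> insert u K \<Longrightarrow> f y z = f v z"
    and wrong_arc: "f x y \<noteq> f u v"
begin

lemma conflict_units: "f u x \<in> {1, -1}" "f u v \<in> {1, -1}" "f y v \<in> {1, -1}"
  by (rule unit; use subset distinct in auto)+

lemma reversed_arc: "f x y = - f u v"
  using unit[of x y] conflict_units(2) wrong_arc subset distinct by auto

lemma schur_complement_other:
  assumes "a \<in> insert v K" "b \<in> insert v K"
  shows "schur_complement f u x a b = f a b"
  using x_like_u[OF assms(1)] x_like_u[OF assms(2)] skewD[OF skew, of u a] skewD[OF skew, of x a]
  by (simp add: schur_complement_def)

lemma schur_complement_y:
  assumes "b \<in> insert v K"
  shows "schur_complement f u x y b = f y b - 2 * f u x * f u v * f u b"
proof -
  have "f y u = - f u v" "f y x = f u v"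
    using y_like_v[of u] reversed_arc skewD[OF skew, of v u] skewD[OF skew, of y x] by simp_all
  then show ?thesis
    by (simp add: schur_complement_def x_like_u[OF assms] algebra_simps)
qed

lemma conflict_minor_6:
  assumes "K = {p, q}"
  shows "principal_minor f [u, x, y, v, p, q] =
    (f y v * f p q - 2 * f u x * f u v * pfaffian4 f u v p q)\<^sup>2"
proof -
  have "f y p = f v p" "f y q = f v q"
    using y_like_v assms by simp_all
  then have "pfaffian4 (schur_complement f u x) y v p q =
      f y v * f p q - 2 * f u x * f u v * pfaffian4 f u v p q"
    using assms
    by (simp add: pfaffian4_def schur_complement_other schur_complement_y algebra_simps)
  then show ?thesis
    by (simp only: principal_minor_schur_complement[OF skew conflict_units(1)]
        principal_minor_4[OF skew_schur_complement[OF skew]])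
qed

lemma abs_pfaffian6_twins_le:
  assumes K: "K = {p, q, r, s}" "distinct [p, q, r, s]"
  shows "\<bar>pfaffian6 f p q y v r s\<bar> \<le> 3"
proof -
  have pq: "f p q \<in> {1, -1}"
    using unit[of p q] K subset by simp
  have "(pfaffian6 f p q y v r s)\<^sup>2 = principal_minor f [p, q, y, v, r, s]"
    by (rule principal_minor_6[OF skew pq, symmetric])
  also have "\<dots> = principal_minor f (y # v # [p, q, r, s])"
    by (rule principal_minor_permute) simp
  also have "\<dots> = (pfaffian4 f p q r s)\<^sup>2"
    using principal_minor_twins[OF skew conflict_units(3), of "[p, q, r, s]"] y_like_v K(1)
    by (simp add: principal_minor_4[OF skew])
  finally have "\<bar>pfaffian6 f p q y v r s\<bar> = \<bar>pfaffian4 f p q r s\<bar>"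
    by (simp add: power2_eq_iff abs_eq_iff)
  also have "\<dots> \<le> 3"
    using K subset(2) by (intro abs_pfaffian4_le) simp_all
  finally show ?thesis .
qed

lemma pfaffian6_schur_complement:
  assumes "K = {p, q, r, s}"
  shows "pfaffian6 (schur_complement f u x) p q y v r s =
    pfaffian6 f p q y v r s - 2 * f u x * f u v * pfaffian6 f p q u v r s"
proof -
  have schur_complement_y': "schur_complement f u x b y = f b y - 2 * f u x * f u v * f b u"
    if "b \<in> insert v K" for b
    using schur_complement_y[OF that] skewD[OF skew_schur_complement[OF skew], of u x b y]
      skewD[OF skew, of b y] skewD[OF skew, of b u] by simp
  show ?thesis
    using assms by (simp add: pfaffian6_def pfaffian4_def schur_complement_other
        schur_complement_y schur_complement_y' algebra_simps)
qed

lemma conflict_minor_8: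
  assumes K: "K = {p, q, r, s}" "distinct [p, q, r, s]"
    and minor: "principal_minor f [u, v, p, q, r, s] = c\<^sup>2" and c: "2 \<le> c"
  shows "(2 * c - 3)\<^sup>2 \<le> principal_minor f [u, x, p, q, y, v, r, s]"
proof -
  let ?g = "schur_complement f u x"
  have pq: "f p q \<in> {1, -1}"
    using unit[of p q] K subset by simp
  have "(pfaffian6 f p q u v r s)\<^sup>2 = principal_minor f [p, q, u, v, r, s]"
    by (rule principal_minor_6[OF skew pq, symmetric])
  also have "\<dots> = principal_minor f [u, v, p, q, r, s]"
    by (rule principal_minor_permute) simp
  finally have "\<bar>pfaffian6 f p q u v r s\<bar> = c"
    using minor c by (auto simp: power2_eq_iff)
  then have "\<bar>2 * f u x * f u v * pfaffian6 f p q u v r s\<bar> = 2 * c"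
    using conflict_units by (auto simp: abs_mult)
  then have "2 * c - 3 \<le> \<bar>pfaffian6 ?g p q y v r s\<bar>"
    using abs_pfaffian6_twins_le[OF K] pfaffian6_schur_complement[OF K(1)] by linarith
  then have "(2 * c - 3)\<^sup>2 \<le> (pfaffian6 ?g p q y v r s)\<^sup>2"
    using c by (intro abs_le_square_iff[THEN iffD1]) simp
  also have "\<dots> = principal_minor ?g [p, q, y, v, r, s]"
    using pq K(1)
    by (intro principal_minor_6[OF skew_schur_complement[OF skew], symmetric])
      (simp add: schur_complement_other)
  also have "\<dots> = principal_minor f [u, x, p, q, y, v, r, s]"
    by (rule principal_minor_schur_complement[OF skew conflict_units(1), symmetric])
  finally show ?thesis .
qed

lemma not_minors_le_square:
  assumes K: "K = {p, q, r, s}" "distinct [p, q, r, s]"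
    and minor: "principal_minor f [u, v, p, q, r, s] = c\<^sup>2" and c: "3 < c"
  shows "\<not> minors_le V f (c\<^sup>2)"
proof
  assume "minors_le V f (c\<^sup>2)"
  moreover have "distinct [u, x, p, q, y, v, r, s]" "set [u, x, p, q, y, v, r, s] \<subseteq> V"
    using distinct subset K by auto
  ultimately have "principal_minor f [u, x, p, q, y, v, r, s] \<le> c\<^sup>2"
    by (rule minors_leD)
  moreover have "c\<^sup>2 < (2 * c - 3)\<^sup>2"
    using c by (intro power_strict_mono) simp_all
  ultimately show False
    using conflict_minor_8[OF K minor] c by simp
qed

lemma conflict_switched:
  assumes "signing V d" "d x = d u" "d y = d v"
  shows "conflict V (switched d f) u x v y K"
proof -
  interpret g: sign_matrix V "switched d f"
    by (rule sign_matrix_switched[OF assms(1)])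
  have "d u \<noteq> 0" "d v \<noteq> 0"
    using signingD[OF assms(1)] subset by force+
  then show ?thesis
    using distinct subset x_like_u y_like_v wrong_arc assms(2,3)
    by unfold_locales (auto simp: switched_def)
qed

lemma arcs_to_partners_eq:
  assumes K: "K = {p, q}" "p \<noteq> q" and bound: "minors_le V f 25"
    and "f u v = 1" "f p q = 1" "pfaffian4 f u v p q = 3"
  shows "f y v = f u x"
proof -
  have "distinct [u, x, y, v, p, q]" "set [u, x, y, v, p, q] \<subseteq> V"
    using distinct subset K by auto
  then have "(f y v - 6 * f u x)\<^sup>2 \<le> 25"
    using minors_leD[OF bound, of "[u, x, y, v, p, q]"] conflict_minor_6[OF K(1)] assms(4-)
    by (simp add: mult_ac)
  then show ?thesis
    using conflict_units by auto
qed

text \<open>The signs make \<open>v \<rightarrow> p \<rightarrow> q \<rightarrow> v\<close> a 3-cycle dominated by \<open>u\<close>.\<close>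

lemma contains_L6_normalized:
  assumes K: "K = {p, q}" "p \<noteq> q" and bound: "minors_le V f 25"
    and signs: "f u v = 1" "f u p = 1" "f u q = 1" "f v p = 1" "f p q = 1" "f v q = -1"
  shows "contains_L 6 V f"
proof -
  have all_V: "distinct [u, x, v, y, p, q]" "{u, x, v, y, p, q} \<subseteq> V"
    using distinct subset K by auto
  have yv: "f y v = f u x"
    using signs by (intro arcs_to_partners_eq[OF K bound]) (simp_all add: pfaffian4_def)
  have arcs: "f x v = 1" "f x p = 1" "f x q = 1" "f x y = -1" "f u y = 1" "f y p = 1" "f y q = -1"
    using x_like_u y_like_v reversed_arc K signs skewD[OF skew, of v u] skewD[OF skew, of u y]
    by auto
  have rev: "f y x = 1" "f v x = -1" "f v y = - f u x" "f q v = 1" "f q x = -1" "f q y = 1"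
    "f q p = -1"
    using skewD[OF skew, of y x] skewD[OF skew, of v x] skewD[OF skew, of v y]
      skewD[OF skew, of q v] skewD[OF skew, of q x] skewD[OF skew, of q y] skewD[OF skew, of q p]
      arcs signs yv
    by simp_all
  show ?thesis
  proof (cases "f u x = 1")
    case True
    then show ?thesis
      using all_V by (intro contains_L_chainI[of "[u, y, x, v, p]" q])
        (auto simp: signs arcs rev yv less_Suc_eq)
  next
    case False
    then have ux: "f u x = -1"
      using conflict_units by simp
    define d :: "'a \<Rightarrow> int" where "d z = (if z = x then -1 else 1)" for z
    have d: "signing V d"
      by (simp add: signing_def d_def)
    interpret g: sign_matrix V "switched d f"
      by (rule sign_matrix_switched[OF d])
    have "contains_L 6 V (switched d f)"
      using all_V by (intro g.contains_L_chainI[of "[u, q, v, x, y]" p])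
        (auto simp: signs arcs rev ux switched_def d_def less_Suc_eq)
    then show ?thesis
      by (rule contains_copy_switched[OF _ d])
  qed
qed

lemma contains_L6_if_minors_le_25:
  assumes K: "K = {p, q}" "p \<noteq> q" and bound: "minors_le V f 25"
    and minor: "principal_minor f [u, v, p, q] = 9"
  shows "contains_L 6 V f"
proof -
  define d where "d z = (if z \<in> {v, y, p, q} then f u z else 1)" for z
  let ?g = "switched d f"
  have all_V: "distinct [u, x, v, y, p, q]" "{u, x, v, y, p, q} \<subseteq> V"
    using distinct subset K by auto
  have "f u y = f u v"
    using y_like_v[of u] skewD[OF skew, of u y] skewD[OF skew, of u v] by simp
  then have d_eq: "d u = 1" "d x = d u" "d y = d v" "d v = f u v" "d p = f u p" "d q = f u q"
    using all_V(1) by (auto simp: d_def)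
  have d: "signing V d"
    using unit[of u] all_V unfolding signing_def d_def by auto
  interpret g: conflict V ?g u x v y K
    by (rule conflict_switched[OF d d_eq(2,3)])
  have dominated: "?g u v = 1" "?g u p = 1" "?g u q = 1"
    using unit[of u v] unit[of u p] unit[of u q] all_V by (auto simp: switched_def d_eq)
  have "(?g p q - ?g v q + ?g v p)\<^sup>2 = 9"
    using minor principal_minor_switched[OF signing_subset[OF d], of "[u, v, p, q]" f] all_V
    by (simp add: principal_minor_4[OF g.skew] pfaffian4_def dominated)
  moreover have "?g p q \<in> {1, -1}" "?g v q \<in> {1, -1}" "?g v p \<in> {1, -1}"
    by (rule g.unit; use all_V in simp)+
  ultimately consider "?g p q = 1" "?g v q = -1" "?g v p = 1"
    | "?g p q = -1" "?g v q = 1" "?g v p = -1"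
    by auto
  then have "contains_L 6 V ?g"
  proof cases
    case 1
    then show ?thesis
      using K bound dominated minors_le_switched_iff[OF d]
      by (intro g.contains_L6_normalized[of p q]) simp_all
  next
    case 2
    then show ?thesis
      using K bound dominated minors_le_switched_iff[OF d] skewD[OF g.skew, of q p]
      by (intro g.contains_L6_normalized[of q p]) auto
  qed
  then show ?thesis
    by (rule contains_copy_switched[OF _ d])
qed

end

section \<open>Copies that recognize every vertex\<close>

locale typed_copy = sign_matrix V f + pattern: sign_matrix I r
  for V :: "'a set" and f and I :: "'b set" and r +
  fixes l :: "'b \<Rightarrow> 'a" and \<tau> :: "'a \<Rightarrow> 'b"
  assumes copy_mem: "i \<in> I \<Longrightarrow> l i \<in> V"
    and type_copy: "i \<in> I \<Longrightarrow> \<tau> (l i) = i"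
    and type_mem: "x \<in> V \<Longrightarrow> \<tau> x \<in> I"
    and sees_copy: "x \<in> V \<Longrightarrow> j \<in> I \<Longrightarrow> j \<noteq> \<tau> x \<Longrightarrow> f x (l j) = r (\<tau> x) j"
begin

lemma copy_sees: "x \<in> V \<Longrightarrow> j \<in> I \<Longrightarrow> j \<noteq> \<tau> x \<Longrightarrow> f (l j) x = r j (\<tau> x)"
  using sees_copy[of x j] skewD[OF skew, of "l j" x] skewD[OF pattern.skew, of j "\<tau> x"] by simp

lemma copy_arcs:
  assumes "i \<in> I" "j \<in> I"
  shows "f (l i) (l j) = r i j"
  using sees_copy[of "l i" j] assms
  by (cases "i = j") (simp_all add: copy_mem type_copy skew_self[OF skew] skew_self[OF pattern.skew])

lemma inj_on_copy: "inj_on l I"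
  using type_copy by (rule inj_on_inverseI)

lemma principal_minor_replace_copy:
  assumes "x \<in> V" "set js \<subseteq> I - {\<tau> x}"
  shows "principal_minor f (x # map l js) = principal_minor r (\<tau> x # js)"
proof -
  let ?l = "l(\<tau> x := x)"
  have "f (?l i) (?l j) = r i j" if "i \<in> I" "j \<in> I" for i j
    using that assms(1)
    by (simp add: sees_copy copy_sees copy_arcs skew_self[OF skew] skew_self[OF pattern.skew])
  moreover have "set (\<tau> x # js) \<subseteq> I"
    using type_mem[OF assms(1)] assms(2) by auto
  ultimately have "principal_minor f (map ?l (\<tau> x # js)) = principal_minor r (\<tau> x # js)"
    unfolding minor_map by (intro minor_cong) blast
  also have "map ?l (\<tau> x # js) = x # map l js"
    using assms(2) by auto
  finally show ?thesis .
qed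

lemma block_transitive:
  assumes bound: "minors_le V f c" and ns: "distinct ns" "set ns = I" "c < 9 * principal_minor r ns"
    and i: "i \<in> I"
  shows "transitive_on f {x \<in> V. \<tau> x = i}"
  unfolding transitive_on_def
proof (intro notI, elim bexE conjE)
  fix x y z assume block: "x \<in> {x \<in> V. \<tau> x = i}" "y \<in> {x \<in> V. \<tau> x = i}" "z \<in> {x \<in> V. \<tau> x = i}"
    and cyc: "f x y = 1" "f y z = 1" "f z x = 1"
  define js where "js = filter (\<lambda>j. j \<noteq> i) ns"
  have js: "distinct js" "set js = I - {i}"
    using ns by (auto simp: js_def)
  have notin: "w \<notin> set (map l js)" if "\<tau> w = i" for w
    using that js(2) type_copy by auto
  have "x \<noteq> y" "y \<noteq> z" "z \<noteq> x"
    using cyc skew_self[OF skew] by auto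
  moreover have "distinct (map l js)"
    using js inj_on_subset[OF inj_on_copy] by (auto simp: distinct_map)
  ultimately have "distinct (x # y # z # map l js)"
    using notin block by auto
  then have "principal_minor f (x # y # z # map l js) \<le> c"
    using block js(2) copy_mem by (intro minors_leD[OF bound]) auto
  moreover have "principal_minor f (x # y # z # map l js) = 9 * principal_minor f (z # map l js)"
    using notin[of z] block js(2)
    by (intro principal_minor_cyclic_triple[OF skew cyc]) (auto simp: sees_copy)
  moreover have "principal_minor f (z # map l js) = principal_minor r (i # js)"
    using principal_minor_replace_copy[of z js] block js(2) by auto
  moreover have "principal_minor r (i # js) = principal_minor r ns"
    using js ns(1,2) i by (intro principal_minor_set_cong) auto
  ultimately show False
    using ns(3) by simp
qed

lemma conflict_if_wrong_arc:
  assumes xy: "x \<in> V" "y \<in> V" "\<tau> x \<noteq> \<tau> y" and wrong: "f x y \<noteq> r (\<tau> x) (\<tau> y)"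
  shows "conflict V f (l (\<tau> x)) x (l (\<tau> y)) y (l ` (I - {\<tau> x, \<tau> y}))"
proof
  note types = type_mem[OF xy(1)] type_mem[OF xy(2)]
  have ne: "l (\<tau> x) \<noteq> x" "l (\<tau> y) \<noteq> y"
    using wrong copy_sees[OF xy(2) types(1) xy(3)] sees_copy[OF xy(1) types(2)] xy(3) by auto
  have l_types: "\<tau> (l (\<tau> x)) = \<tau> x" "\<tau> (l (\<tau> y)) = \<tau> y"
    using type_copy types by simp_all
  then show "distinct [l (\<tau> x), x, l (\<tau> y), y]"
    using ne xy(3) by auto
  show "l ` (I - {\<tau> x, \<tau> y}) \<inter> {l (\<tau> x), x, l (\<tau> y), y} = {}"
    using l_types type_copy by auto
  show "{l (\<tau> x), x, l (\<tau> y), y} \<subseteq> V" "l ` (I - {\<tau> x, \<tau> y}) \<subseteq> V"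
    using xy types copy_mem by auto
  show "f x z = f (l (\<tau> x)) z" if z: "z \<in> insert (l (\<tau> y)) (l ` (I - {\<tau> x, \<tau> y}))" for z
  proof -
    obtain j where "j \<in> I" "j \<noteq> \<tau> x" "z = l j"
      using z types xy(3) by auto
    then show ?thesis
      using xy types by (simp add: sees_copy copy_arcs)
  qed
  show "f y z = f (l (\<tau> y)) z" if z: "z \<in> insert (l (\<tau> x)) (l ` (I - {\<tau> x, \<tau> y}))" for z
  proof -
    obtain j where "j \<in> I" "j \<noteq> \<tau> y" "z = l j"
      using z types xy(3) by auto
    then show ?thesis
      using xy types by (simp add: sees_copy copy_arcs)
  qed
  show "f x y \<noteq> f (l (\<tau> x)) (l (\<tau> y))"
    using wrong copy_arcs types by simp
qed

lemma obtain_conflict_listing: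
  assumes xy: "x \<in> V" "y \<in> V" "\<tau> x \<noteq> \<tau> y" and ns: "distinct ns" "set ns = I"
  obtains ks where "distinct ks" "set ks = l ` (I - {\<tau> x, \<tau> y})" "length ks = length ns - 2"
    "principal_minor f (l (\<tau> x) # l (\<tau> y) # ks) = principal_minor r ns"
proof -
  note types = type_mem[OF xy(1)] type_mem[OF xy(2)]
  define js where "js = filter (\<lambda>j. j \<noteq> \<tau> x \<and> j \<noteq> \<tau> y) ns"
  have js: "distinct js" "set js = I - {\<tau> x, \<tau> y}"
    using ns by (auto simp: js_def)
  have "distinct (map l js)"
    using js inj_on_subset[OF inj_on_copy] by (auto simp: distinct_map)
  moreover have "set (map l js) = l ` (I - {\<tau> x, \<tau> y})"
    by (simp add: js(2))
  moreover have "length (map l js) = length ns - 2"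
    using distinct_card[OF js(1)] distinct_card[OF ns(1)] types xy(3)
    by (simp add: js(2) ns(2) card_Diff_subset)
  moreover have "principal_minor f (l (\<tau> x) # map l (\<tau> y # js)) =
      principal_minor r (\<tau> (l (\<tau> x)) # \<tau> y # js)"
    using types xy(3) js(2) by (intro principal_minor_replace_copy) (auto simp: copy_mem type_copy)
  moreover have "principal_minor r (\<tau> x # \<tau> y # js) = principal_minor r ns"
    using js ns types xy(3) by (intro principal_minor_set_cong) auto
  ultimately show thesis
    using that types by (simp add: type_copy)
qed

lemma transitive_blowup_if_consistent:
  assumes "\<And>x y. x \<in> V \<Longrightarrow> y \<in> V \<Longrightarrow> \<tau> x \<noteq> \<tau> y \<Longrightarrow> f x y = r (\<tau> x) (\<tau> y)"
    and "\<And>i. i \<in> I \<Longrightarrow> transitive_on f {x \<in> V. \<tau> x = i}"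
  shows "transitive_blowup V f I r \<tau>"
proof
  show "\<tau> ` V = I"
    using type_mem type_copy copy_mem by force
qed (use assms in auto)

end

definition is_signed_row :: "'b set \<Rightarrow> ('b \<Rightarrow> 'b \<Rightarrow> int) \<Rightarrow> ('b \<Rightarrow> int) \<Rightarrow> bool" where
  "is_signed_row I r X \<longleftrightarrow> (\<exists>i\<in>I. \<exists>s\<in>{1, -1}. \<forall>j\<in>I - {i}. X j = s * r i j)"

lemma is_signed_row_copy_mem:
  assumes "copy_in V f I r l" "i \<in> I"
  shows "is_signed_row I r (\<lambda>j. f (l i) (l j))"
  using assms unfolding is_signed_row_def copy_in_def
  by (intro bexI[of _ i] bexI[of _ 1]) simp_all

lemma (in sign_matrix) row_eq_signed_row:
  assumes V: "\<not> is_singleton V" "i \<in> V" "k \<in> V" and s: "s \<in> {1, -1}"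
    and row: "\<And>j. j \<in> V - {k} \<Longrightarrow> f i j = s * f k j"
  shows "k = i" "s = 1"
proof -
  show "k = i"
  proof (rule ccontr)
    assume "k \<noteq> i"
    then have "s * f k i = 0"
      using row[of i] V(2) skew_self[OF skew, of i] by simp
    then show False
      using s unit[OF V(3,2) \<open>k \<noteq> i\<close>] by auto
  qed
  obtain j where j: "j \<in> V" "j \<noteq> i"
    using V unfolding is_singleton_def by blast
  then have "f i j = s * f i j"
    using row[of j] \<open>k = i\<close> by simp
  then show "s = 1"
    using unit[OF V(2) j(1)] j(2) by auto
qed

lemma (in sign_matrix) obtain_typed_copy:
  assumes copy: "copy_in V f I r l" and r: "sign_matrix I r" and I: "\<not> is_singleton I"
    and rows: "\<And>x. x \<in> V \<Longrightarrow> is_signed_row I r (\<lambda>j. f x (l j))"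
  obtains d \<tau> where "signing V d" "typed_copy V (switched d f) I r l \<tau>"
proof -
  interpret r: sign_matrix I r by (rule r)
  have l: "\<And>i. i \<in> I \<Longrightarrow> l i \<in> V" and arcs: "\<And>i j. i \<in> I \<Longrightarrow> j \<in> I \<Longrightarrow> f (l i) (l j) = r i j"
    using copy unfolding copy_in_def by blast+
  have "\<forall>x\<in>V. \<exists>i. i \<in> I \<and> (\<exists>s\<in>{1, -1}. \<forall>j\<in>I - {i}. f x (l j) = s * r i j)"
    using rows unfolding is_signed_row_def by blast
  from bchoice[OF this] obtain \<tau> where "\<forall>x\<in>V. \<exists>s. \<tau> x \<in> I \<and> s \<in> {1, -1} \<and>
      (\<forall>j\<in>I - {\<tau> x}. f x (l j) = s * r (\<tau> x) j)"
    by blast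
  from bchoice[OF this] obtain d where "\<forall>x\<in>V. \<tau> x \<in> I \<and> d x \<in> {1, -1} \<and>
      (\<forall>j\<in>I - {\<tau> x}. f x (l j) = d x * r (\<tau> x) j)"
    by blast
  then have \<tau>: "\<tau> x \<in> I" and d: "d x \<in> {1, -1}"
    and row: "\<And>j. j \<in> I - {\<tau> x} \<Longrightarrow> f x (l j) = d x * r (\<tau> x) j" if "x \<in> V" for x
    using that by blast+
  have copy_type: "\<tau> (l i) = i" "d (l i) = 1" if i: "i \<in> I" for i
  proof -
    have "r i j = d (l i) * r (\<tau> (l i)) j" if "j \<in> I - {\<tau> (l i)}" for j
      using row[OF l[OF i] that] arcs[OF i] that by simp
    then show "\<tau> (l i) = i" "d (l i) = 1"
      using r.row_eq_signed_row[OF I i \<tau>[OF l[OF i]] d[OF l[OF i]]] by blast+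
  qed
  have signing: "signing V d"
    using d by (simp add: signing_def)
  interpret g: sign_matrix V "switched d f"
    by (rule sign_matrix_switched[OF signing])
  have "typed_copy V (switched d f) I r l \<tau>"
  proof
    show "switched d f x (l j) = r (\<tau> x) j" if "x \<in> V" "j \<in> I" "j \<noteq> \<tau> x" for x j
      using row[of x j] d[of x] that copy_type(2)[OF that(2)] by (auto simp: switched_def)
  qed (use l copy_type \<tau> in auto)
  then show thesis
    by (rule that[OF signing])
qed

section \<open>The classification\<close>

lemma interval_1_4: "{1..4::nat} = {1, 2, 3, 4}"
  by (auto simp: numeral_eq_Suc le_Suc_eq)

lemma interval_1_6: "{1..6::nat} = {1, 2, 3, 4, 5, 6}"
  by (auto simp: numeral_eq_Suc le_Suc_eq)

lemma is_signed_row_L4: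
  assumes "signing {1..4} X"
  shows "is_signed_row {1..4} (L_sign 4) X"
proof -
  have "X 1 = 1 \<or> X 1 = -1" "X 2 = 1 \<or> X 2 = -1" "X 3 = 1 \<or> X 3 = -1" "X 4 = 1 \<or> X 4 = -1"
    using assms unfolding signing_def by auto
  then show ?thesis
    unfolding is_signed_row_def interval_1_4
    by (elim disjE; simp add: L_sign_less L_sign_greater insert_Diff_if)
qed

text \<open>The linear forms are the Pfaffians of a new vertex together with five vertices of \<open>L\<^sub>6\<close>.\<close>

lemma is_signed_row_L6:
  assumes "signing {1..6} X"
    and "\<bar>- 3 * X 2 + X 3 + X 4 - 3 * X 5 + X 6\<bar> \<le> 5" "\<bar>- 3 * X 1 + 3 * X 3 - X 4 - X 5 + X 6\<bar> \<le> 5"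
      "\<bar>- X 1 + 3 * X 2 - 3 * X 4 + X 5 + X 6\<bar> \<le> 5" "\<bar>X 1 + X 2 - 3 * X 3 + 3 * X 5 + X 6\<bar> \<le> 5"
      "\<bar>3 * X 1 - X 2 - X 3 + 3 * X 4 + X 6\<bar> \<le> 5"
  shows "is_signed_row {1..6} (L_sign 6) X"
proof -
  let ?rows = "\<lambda>s. X 2 = s \<and> X 3 = s \<and> X 4 = s \<and> X 5 = s \<and> X 6 = -s \<or>
    X 1 = -s \<and> X 3 = s \<and> X 4 = s \<and> X 5 = s \<and> X 6 = s \<or>
    X 1 = -s \<and> X 2 = -s \<and> X 4 = s \<and> X 5 = s \<and> X 6 = -s \<or>
    X 1 = -s \<and> X 2 = -s \<and> X 3 = -s \<and> X 5 = s \<and> X 6 = s \<or>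
    X 1 = -s \<and> X 2 = -s \<and> X 3 = -s \<and> X 4 = -s \<and> X 6 = -s \<or>
    X 1 = s \<and> X 2 = -s \<and> X 3 = s \<and> X 4 = -s \<and> X 5 = s"
  have "X 1 = 1 \<or> X 1 = -1" "X 2 = 1 \<or> X 2 = -1" "X 3 = 1 \<or> X 3 = -1"
    "X 4 = 1 \<or> X 4 = -1" "X 5 = 1 \<or> X 5 = -1" "X 6 = 1 \<or> X 6 = -1"
    using assms(1) unfolding signing_def by auto
  then have "\<exists>s\<in>{1, -1}. ?rows s"
    using assms(2-) by (elim disjE) (simp_all only:, simp_all)
  then obtain s where s: "s \<in> {1, -1}" and "?rows s"
    by (rule bexE)
  then have "\<exists>i\<in>{1..6}. \<forall>j\<in>{1..6} - {i}. X j = s * L_sign 6 i j"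
    unfolding interval_1_6 by (simp add: L_sign_less L_sign_greater insert_Diff_if)
  then show ?thesis
    using s unfolding is_signed_row_def by blast
qed

lemma (in sign_matrix) is_signed_row_copy_L6:
  assumes copy: "copy_in V f {1..6} (L_sign 6) l" and bound: "minors_le V f 25"
    and x: "x \<in> V" "x \<notin> l ` {1..6}"
  shows "is_signed_row {1..6} (L_sign 6) (\<lambda>j. f x (l j))"
proof -
  have l: "inj_on l {1..6}" "\<And>i. i \<in> {1..6} \<Longrightarrow> l i \<in> V"
    and arcs: "\<And>i j. i \<in> {1..6} \<Longrightarrow> j \<in> {1..6} \<Longrightarrow> f (l i) (l j) = L_sign 6 i j"
    using copy unfolding copy_in_def by blast+
  have signing: "signing {1..6} (\<lambda>j. f x (l j))"
    unfolding signing_def using l(2) x by (intro ballI unit) auto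
  have pfaffian: "\<bar>pfaffian6 f x (l a) (l b) (l c) (l d) (l e)\<bar> \<le> 5"
    if "distinct [a, b, c, d, e]" "{a, b, c, d, e} \<subseteq> {1..6}" for a b c d e
  proof -
    have "distinct (map l [a, b, c, d, e])"
      using that inj_on_subset[OF l(1)] by (simp only: distinct_map list.set)
    moreover have "x \<notin> set (map l [a, b, c, d, e])"
      using x(2) that(2) by auto
    ultimately have "principal_minor f (x # map l [a, b, c, d, e]) \<le> 25"
      using x(1) l(2) that(2) by (intro minors_leD[OF bound]) auto
    then have "(pfaffian6 f x (l a) (l b) (l c) (l d) (l e))\<^sup>2 \<le> 5\<^sup>2"
      using signingD[OF signing, of a] that(2) by (simp add: principal_minor_6[OF skew])
    then show ?thesis
      using abs_le_square_iff[of _ "5 :: int"] by simp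
  qed
  note expand = pfaffian6_def pfaffian4_def arcs L_sign_less
  show ?thesis
    by (rule is_signed_row_L6[OF signing])
      (use pfaffian[of 2 3 4 5 6] in \<open>simp add: expand\<close>,
       use pfaffian[of 1 3 4 5 6] in \<open>simp add: expand\<close>,
       use pfaffian[of 1 2 4 5 6] in \<open>simp add: expand\<close>,
       use pfaffian[of 1 2 3 5 6] in \<open>simp add: expand\<close>,
       use pfaffian[of 1 2 3 4 6] in \<open>simp add: expand\<close>)
qed

lemma (in sign_matrix) is_signed_row_copy:
  assumes m: "m \<in> {4, 6}" and copy: "copy_in V f {1..m} (L_sign m) l"
    and bound: "minors_le V f 25" and x: "x \<in> V"
  shows "is_signed_row {1..m} (L_sign m) (\<lambda>j. f x (l j))"
proof (cases "x \<in> l ` {1..m}")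
  case True
  then show ?thesis
    using is_signed_row_copy_mem[OF copy] by blast
next
  case False
  then have "signing {1..m} (\<lambda>j. f x (l j))"
    using copy x unfolding signing_def copy_in_def by (intro ballI unit) auto
  then show ?thesis
    using m is_signed_row_L4 is_signed_row_copy_L6[of l x] copy bound x False by blast
qed

lemma L_copy_consistent:
  assumes typed: "typed_copy V f {1..m} (L_sign m) l \<tau>" and m: "m \<in> {4, 6}"
    and bound: "minors_le V f 25" and no_L6: "m = 4 \<Longrightarrow> \<not> contains_L 6 V f"
    and xy: "x \<in> V" "y \<in> V" "\<tau> x \<noteq> \<tau> y"
  shows "f x y = L_sign m (\<tau> x) (\<tau> y)"
proof (rule ccontr)
  interpret typed_copy V f "{1..m}" "L_sign m" l \<tau> by fact
  let ?u = "l (\<tau> x)" and ?v = "l (\<tau> y)"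
  assume "f x y \<noteq> L_sign m (\<tau> x) (\<tau> y)"
  then interpret conflict V f ?u x ?v y "l ` ({1..m} - {\<tau> x, \<tau> y})"
    by (rule conflict_if_wrong_arc[OF xy])
  obtain ns where ns: "distinct ns" "set ns = {1..m}"
    using finite_distinct_list[of "{1..m}"] by blast
  have "length ns = m" "principal_minor (L_sign m) ns = (int m - 1)\<^sup>2"
    using principal_minor_L_sign[OF _ _ ns] m distinct_card[OF ns(1)] ns(2) by auto
  then obtain ks where ks: "distinct ks" "set ks = l ` ({1..m} - {\<tau> x, \<tau> y})" "length ks = m - 2"
    and minor: "principal_minor f (?u # ?v # ks) = (int m - 1)\<^sup>2"
    using obtain_conflict_listing[OF xy ns] by metis
  consider "m = 4" | "m = 6"
    using m by blast
  then show False
  proof cases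
    case 1
    then obtain p q where "ks = [p, q]"
      using ks(3) by (auto simp: length_Suc_conv numeral_eq_Suc)
    then have "contains_L 6 V f"
      using ks minor 1 by (intro contains_L6_if_minors_le_25[of p q, OF _ _ bound]) auto
    then show False
      using no_L6 1 by blast
  next
    case 2
    then obtain p q r s where "ks = [p, q, r, s]"
      using ks(3) by (auto simp: length_Suc_conv numeral_eq_Suc)
    then have "\<not> minors_le V f (5\<^sup>2)"
      using ks minor 2 by (intro not_minors_le_square[of p q r s]) auto
    then show False
      using bound by simp
  qed
qed

lemma L_copy_blowup:
  assumes typed: "typed_copy V f {1..m} (L_sign m) l \<tau>" and m: "m \<in> {4, 6}"
    and bound: "minors_le V f 25" and no_L6: "m = 4 \<Longrightarrow> \<not> contains_L 6 V f"
  shows "transitive_blowup V f {1..m} (L_sign m) \<tau>"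
proof -
  interpret typed_copy V f "{1..m}" "L_sign m" l \<tau> by fact
  obtain ns where ns: "distinct ns" "set ns = {1..m}"
    using finite_distinct_list[of "{1..m}"] by blast
  have "25 < 9 * principal_minor (L_sign m) ns"
    using m principal_minor_L_sign[OF _ _ ns] by auto
  then show ?thesis
    using L_copy_consistent[OF typed m bound no_L6] block_transitive[OF bound ns]
    by (intro transitive_blowup_if_consistent)
qed

lemma (in sign_matrix) switched_blowup_L:
  assumes m: "m \<in> {4, 6}" and contains: "contains_L m V f" and bound: "minors_le V f 25"
    and no_L6: "m = 4 \<Longrightarrow> \<not> contains_L 6 V f"
  shows "switched_blowup V f {1..m} (L_sign m)"
proof -
  obtain c l where c: "signing V c" and copy: "copy_in V (switched c f) {1..m} (L_sign m) l"
    using contains unfolding contains_copy_def by blast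
  interpret g: sign_matrix V "switched c f"
    by (rule sign_matrix_switched[OF c])
  have bound_g: "minors_le V (switched c f) 25"
    using bound minors_le_switched_iff[OF c] by blast
  have "\<not> is_singleton {1..m}"
    using m by (auto simp: is_singleton_altdef)
  then obtain d \<tau> where d: "signing V d"
    and typed: "typed_copy V (switched d (switched c f)) {1..m} (L_sign m) l \<tau>"
    using g.obtain_typed_copy[OF copy sign_matrix_L_sign] g.is_signed_row_copy[OF m copy bound_g]
    by blast
  have "transitive_blowup V (switched d (switched c f)) {1..m} (L_sign m) \<tau>"
  proof (rule L_copy_blowup[OF typed m])
    show "minors_le V (switched d (switched c f)) 25"
      using bound_g minors_le_switched_iff[OF d] by blast
    show "\<not> contains_L 6 V (switched d (switched c f))" if "m = 4"
      using no_L6[OF that] contains_copy_switched[OF _ d] contains_copy_switched[OF _ c] by blast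
  qed
  then show ?thesis
    using switched_blowup_switched c d unfolding switched_blowup_def by blast
qed

lemma (in sign_matrix) transitive_blowup_L2:
  assumes z: "z \<in> V" and V: "\<not> is_singleton V" and source: "\<And>x. x \<in> V - {z} \<Longrightarrow> f z x = 1"
    and trans: "transitive_on f (V - {z})"
  shows "transitive_blowup V f {1..2} (L_sign 2) (\<lambda>x. if x = z then 2 else 1)"
proof -
  let ?\<tau> = "\<lambda>x. if x = z then 2 else 1 :: nat"
  interpret L2: sign_matrix "{1..2}" "L_sign 2"
    by (rule sign_matrix_L_sign)
  have sink: "f x z = -1" if "x \<in> V - {z}" for x
    using source[OF that] skewD[OF skew, of x z] by simp
  show ?thesis
  proof
    have "V - {z} \<noteq> {}"
      using z V unfolding is_singleton_def by blast
    then show "?\<tau> ` V = {1..2}"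
      using z by (auto simp: numeral_2_eq_2 le_Suc_eq)
    show "f x y = L_sign 2 (?\<tau> x) (?\<tau> y)" if "x \<in> V" "y \<in> V" "?\<tau> x \<noteq> ?\<tau> y" for x y
      using that source[of y] sink[of x] by (auto simp: L_sign_less L_sign_greater split: if_splits)
    show "transitive_on f {x \<in> V. ?\<tau> x = i}" if "i \<in> {1..2}" for i
    proof (cases "i = 1")
      case True
      then have "{x \<in> V. ?\<tau> x = i} = V - {z}"
        by auto
      then show ?thesis
        using trans by simp
    next
      case False
      then have "{x \<in> V. ?\<tau> x = i} \<subseteq> {z}"
        by auto
      then show ?thesis
        by (rule transitive_on_subset[rotated]) (simp add: transitive_on_def skew_self[OF skew])
    qed
  qed
qed

lemma (in sign_matrix) contains_L4_if_not_transitive: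
  assumes z: "z \<in> V" and source: "\<And>x. x \<in> V - {z} \<Longrightarrow> f z x = 1"
    and not_trans: "\<not> transitive_on f (V - {z})"
  shows "contains_L 4 V f"
proof -
  obtain a b c where abc: "a \<in> V - {z}" "b \<in> V - {z}" "c \<in> V - {z}"
    "f a b = 1" "f b c = 1" "f c a = 1"
    using not_trans unfolding transitive_on_def by blast
  have "distinct [c, z, a, b]"
    using abc skew_self[OF skew] by auto
  moreover have "f a c = -1"
    using skewD[OF skew, of a c] abc(6) by simp
  ultimately show ?thesis
    using abc z source by (intro contains_L_chainI[of "[z, a, b]" c]) (auto simp: less_Suc_eq)
qed

lemma (in sign_matrix) switched_blowup_L2_or_contains_L4:
  assumes z: "z \<in> V" and V: "\<not> is_singleton V"
  shows "switched_blowup V f {1..2} (L_sign 2) \<or> contains_L 4 V f"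
proof -
  define d where "d x = (if x = z then 1 else f z x)" for x
  have d: "signing V d"
    using unit z by (simp add: signing_def d_def)
  interpret g: sign_matrix V "switched d f"
    by (rule sign_matrix_switched[OF d])
  have source: "switched d f z x = 1" if "x \<in> V - {z}" for x
    using unit[OF z, of x] that by (auto simp: switched_def d_def)
  show ?thesis
  proof (cases "transitive_on (switched d f) (V - {z})")
    case True
    then show ?thesis
      using d g.transitive_blowup_L2[OF z V source] unfolding switched_blowup_def by blast
  next
    case False
    then show ?thesis
      using contains_copy_switched[OF g.contains_L4_if_not_transitive[OF z source] d] by blast
  qed
qed

lemma (in sign_matrix) switched_blowup_L_if_minors_le:
  assumes "z \<in> V" "\<not> is_singleton V" "minors_le V f 25"
  shows "\<exists>m\<in>{2, 4, 6}. switched_blowup V f {1..m} (L_sign m)"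
  using switched_blowup_L2_or_contains_L4[OF assms(1,2)] switched_blowup_L[OF _ _ assms(3)]
  by (cases "contains_L 6 V f") auto

lemma switching_blowup_of_L_if_in_tournaments_D:
  assumes T: "tournament T" and card: "2 \<le> card (pverts T)" and D: "T \<in> tournaments_D k" "0 < k" "k \<le> 5"
  shows "\<exists>m\<in>{2, 4, 6}. switching_equivalent_to_blowup_of T (Ltour m)"
proof -
  interpret sign_matrix "pverts T" "arc_sign T"
    by (rule sign_matrix_arc_sign[OF T])
  have "minors_le (pverts T) (arc_sign T) ((int k)\<^sup>2)"
    using D tournaments_D_iff_minors_le[OF T] by blast
  moreover have "(int k)\<^sup>2 \<le> 25"
    using power_mono[of "int k" 5 2] D(3) by simp
  ultimately have "minors_le (pverts T) (arc_sign T) 25"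
    unfolding minors_le_def by fastforce
  moreover have "pverts T \<noteq> {}" "\<not> is_singleton (pverts T)"
    using card by (auto simp: is_singleton_altdef)
  ultimately show ?thesis
    using switched_blowup_L_if_minors_le switching_equivalent_to_blowup_of_iff[OF T tournament_Ltour]
    by auto
qed

theorem theorem3p12:
  fixes T :: "'a pair_pre_digraph"
  assumes "tournament T" and "card (pverts T) \<ge> 2"
  shows "(T \<in> tournaments_D 1 \<longleftrightarrow> switching_equivalent_to_blowup_of T (Ltour 2)) \<and>
    (T \<in> tournaments_D 3 - tournaments_D 1 \<longleftrightarrow> switching_equivalent_to_blowup_of T (Ltour 4)) \<and>
    (T \<in> tournaments_D 3 \<longleftrightarrow>
      (\<exists>k\<in>{2, 4}. switching_equivalent_to_blowup_of T (Ltour k))) \<and>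
    (T \<in> tournaments_D 5 - tournaments_D 3 \<longleftrightarrow> switching_equivalent_to_blowup_of T (Ltour 6)) \<and>
    (T \<in> tournaments_D 5 \<longleftrightarrow>
      (\<exists>k\<in>{2, 4, 6}. switching_equivalent_to_blowup_of T (Ltour k)))"
proof -
  let ?B = "\<lambda>m. switching_equivalent_to_blowup_of T (Ltour m)"
  have in_D: "T \<in> tournaments_D k \<longleftrightarrow> m - 1 \<le> k" if "?B m" "m \<in> {2, 4, 6}" "0 < k" for m k
    using switching_blowup_in_tournaments_D_iff[OF assms(1) tournament_Ltour that(1,3)]
      Ltour_in_tournaments_D_iff[of m k] that(2,3) by auto
  have "T \<in> tournaments_D k \<longleftrightarrow> (\<exists>m\<in>{2, 4, 6}. ?B m \<and> m - 1 \<le> k)" if "0 < k" "k \<le> 5" for k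
    using switching_blowup_of_L_if_in_tournaments_D[OF assms _ that] in_D that(1) by blast
  from this[of 1] this[of 3] this[of 5]
  have "T \<in> tournaments_D 1 \<longleftrightarrow> ?B 2" "T \<in> tournaments_D 3 \<longleftrightarrow> ?B 2 \<or> ?B 4"
    "T \<in> tournaments_D 5 \<longleftrightarrow> ?B 2 \<or> ?B 4 \<or> ?B 6"
    by simp_all
  moreover have "?B 4 \<Longrightarrow> T \<notin> tournaments_D 1" "?B 6 \<Longrightarrow> T \<notin> tournaments_D 3"
    using in_D[of 4 1] in_D[of 6 3] by simp_all
  ultimately show ?thesis
    by auto
qed

end
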